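(* The 1-constrained CKP hierarchy $$\frac{\partial \mathcal{L}}{\partial t_{2n+1}}=[B_{2n+1},\mathcal{L}],\qquad n=0,1,2,\dots,\qquad \mathcal{L}=\partial+q\partial^{-1}r+r\partial^{-1}q,\quad B_m=(\mathcal{L}^m)_+,$$ can be reduced to the mKdV hierarchy by the condition $q=r$.
   Context: Pseudo-differential operators. Here $\partial=\partial/\partial x$, a subscript $x$ denotes the $x$-derivative, and $\partial^{-1}$ is the formal inverse of $\partial$. Pseudo-differential operators are formal series $P=\sum_{i\le N}p_i\partial^i$ whose coefficients are functions of $x$ and of the times, multiplied by the rule $\partial^i f=\sum_{k\ge0}\binom{i}{k}(\partial^k f)\,\partial^{i-k}$, $i\in\mathbb{Z}$. The differential part is $P_+=\sum_{i\ge0}p_i\partial^i$, and the formal adjoint is $P^*=\sum_i(-1)^i\partial^i p_i$. 1-constrained CKP hierarchy. Its Lax operator is $\mathcal{L}=\partial+q\partial^{-1}r+r\partial^{-1}q$, where $q,r$ are functions of $t_1,t_3,t_5,\dots$ (with $q_{t_1}=q_x$, $r_{t_1}=r_x$); it satisfies $\mathcal{L}^*=-\mathcal{L}$. With $B_m=(\mathcal{L}^m)_+$, only the odd flows $\partial\mathcal{L}/\partial t_{2n+1}=[B_{2n+1},\mathcal{L}]$, $n\ge0$, are present, and $q,r$ satisfy the eigenfunction equations $q_{t_m}=B_m(q)$, $r_{t_m}=-B_m^*(r)=B_m(r)$ for odd $m$. mKdV hierarchy. This is the hierarchy of evolution equations generated from the trivial flow $u_{t_1}=u_x$ by the mKdV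 recursion operator $\partial^2+\frac23u^2+\frac23u_x\partial^{-1}u$, i.e. $u_{t_{m+2}}=\big(\partial^2+\frac23u^2+\frac23u_x\partial^{-1}u\big)u_{t_m}$ for odd $m$, where $\partial^{-1}$ acts on functions as formal antiderivative in $x$. Its first nontrivial member is the mKdV equation $u_{t_3}=u_{xxx}+u^2u_x$. Under the rescaling $q=\frac{\sqrt3}{6}u$ the recursion operator takes the form $\partial^2+8q^2+8q_x\partial^{-1}q$ and the mKdV equation the form $q_{t_3}=q_{xxx}+12q^2q_x$; hierarchies related by this rescaling are regarded as the same mKdV hierarchy. *)

theory Defs
  imports Complex_Main "HOL-Library.Poly_Mapping"
begin

section \<open>Functions of \<open>x\<close> and the times\<close>

text \<open>
  The functions of \<open>x\<close> and \<open>t\<^sub>1, t\<^sub>3, t\<^sub>5, \<dots>\<close> form a commutative real algebra on which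
  \<open>\<partial>/\<partial>x\<close> acts as a linear derivation, and nothing else about them is used.  A complex algebra is
  covered as well. Zero divisors are allowed, as they occur among smooth functions.
\<close>

class diff_algebra = comm_ring_1 + real_algebra_1 +
  fixes dx :: "'a \<Rightarrow> 'a"
  assumes dx_add: "dx (f + g) = dx f + dx g"
    and dx_scaleR: "dx (c *\<^sub>R f) = c *\<^sub>R dx f"
    and dx_mult: "dx (f * g) = dx f * g + f * dx g"

definition time_derivative :: "('a::diff_algebra \<Rightarrow> 'a) \<Rightarrow> bool" where
  "time_derivative D \<longleftrightarrow>
     (\<forall>f g. D (f + g) = D f + D g) \<and>
     (\<forall>c f. D (c *\<^sub>R f) = c *\<^sub>R D f) \<and>
     (\<forall>f g. D (f * g) = D f * g + f * D g) \<and>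
     (\<forall>f. D (dx f) = dx (D f))"

text \<open>\<open>Dt m\<close> is \<open>\<partial>/\<partial>t\<^sub>m\<close>; its values at even \<open>m\<close> are irrelevant.\<close>

definition odd_time_derivatives :: "(nat \<Rightarrow> 'a::diff_algebra \<Rightarrow> 'a) \<Rightarrow> bool" where
  "odd_time_derivatives Dt \<longleftrightarrow>
     (\<forall>m. odd m \<longrightarrow> time_derivative (Dt m)) \<and>
     (\<forall>m k f. odd m \<longrightarrow> odd k \<longrightarrow> Dt m (Dt k f) = Dt k (Dt m f))"


section \<open>Pseudo-differential operators\<close>

text \<open>\<open>pdo_coeff P i\<close> is the coefficient of \<open>\<partial>\<close> to the power \<open>i\<close>, written to the left of it.\<close>

typedef (overloaded) 'a pdo = "{p :: int \<Rightarrow> 'a::zero. \<exists>N. \<forall>i>N. p i = 0}"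
  morphisms pdo_coeff Abs_pdo
  by (rule exI[of _ "\<lambda>_. 0"]) simp

setup_lifting type_definition_pdo

lift_definition pdo_monom :: "'a::zero \<Rightarrow> int \<Rightarrow> 'a pdo" is
  "\<lambda>f n i. if i = n then f else 0"
proof -
  fix f :: 'a and n :: int
  show "\<exists>N. \<forall>i>N. (if i = n then f else 0) = 0"
    by (intro exI[of _ n]) auto
qed

text \<open>
  Multiplication extends \<open>p \<partial>\<^sup>i \<cdot> q \<partial>\<^sup>j = \<Sum>\<^sub>l (i choose l) p (\<partial>\<^sup>l q) \<partial>\<^sup>i\<^sup>+\<^sup>j\<^sup>-\<^sup>l\<close>.  The coefficient of
  \<open>\<partial>\<^sup>k\<close> collects the terms with \<open>l = i + j - k\<close>; the index set is finite because the orders of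
  both factors are bounded above.
\<close>

instantiation pdo :: (diff_algebra) "{zero, one, plus, minus, times}"
begin

lift_definition zero_pdo :: "'a pdo" is "\<lambda>_. 0"
  by simp

definition one_pdo :: "'a pdo" where
  "one_pdo = pdo_monom 1 0"

lift_definition plus_pdo :: "'a pdo \<Rightarrow> 'a pdo \<Rightarrow> 'a pdo" is "\<lambda>p q i. p i + q i"
proof -
  fix p q :: "int \<Rightarrow> 'a"
  assume "\<exists>N. \<forall>i>N. p i = 0" "\<exists>N. \<forall>i>N. q i = 0"
  then obtain N M where "\<forall>i>N. p i = 0" "\<forall>i>M. q i = 0" by blast
  then show "\<exists>N. \<forall>i>N. p i + q i = 0" by (intro exI[of _ "max N M"]) auto
qed

lift_definition minus_pdo :: "'a pdo \<Rightarrow> 'a pdo \<Rightarrow> 'a pdo" is "\<lambda>p q i. p i - q i"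
proof -
  fix p q :: "int \<Rightarrow> 'a"
  assume "\<exists>N. \<forall>i>N. p i = 0" "\<exists>N. \<forall>i>N. q i = 0"
  then obtain N M where "\<forall>i>N. p i = 0" "\<forall>i>M. q i = 0" by blast
  then show "\<exists>N. \<forall>i>N. p i - q i = 0" by (intro exI[of _ "max N M"]) auto
qed

lift_definition times_pdo :: "'a pdo \<Rightarrow> 'a pdo \<Rightarrow> 'a pdo" is
  "\<lambda>p q k. \<Sum>(i, j) \<in> {(i, j). p i \<noteq> 0 \<and> q j \<noteq> 0 \<and> k \<le> i + j}.
     (real_of_int i gchoose nat (i + j - k)) *\<^sub>R (p i * (dx ^^ nat (i + j - k)) (q j))"
proof -
  fix p q :: "int \<Rightarrow> 'a"
  assume "\<exists>N. \<forall>i>N. p i = 0" "\<exists>N. \<forall>i>N. q i = 0"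
  then obtain N M where NM: "\<forall>i>N. p i = 0" "\<forall>i>M. q i = 0" by blast
  have "{(i, j). p i \<noteq> 0 \<and> q j \<noteq> 0 \<and> k \<le> i + j} = {}" if "k > N + M" for k
  proof -
    have "p i = 0 \<or> q j = 0" if "k \<le> i + j" for i j
    proof -
      have "i > N \<or> j > M" using that \<open>k > N + M\<close> by linarith
      then show ?thesis using NM by blast
    qed
    then show ?thesis by auto
  qed
  then show "\<exists>N. \<forall>k>N. (\<Sum>(i, j) \<in> {(i, j). p i \<noteq> 0 \<and> q j \<noteq> 0 \<and> k \<le> i + j}.
      (real_of_int i gchoose nat (i + j - k)) *\<^sub>R (p i * (dx ^^ nat (i + j - k)) (q j))) = 0"
    by (intro exI[of _ "N + M"]) (metis (no_types, lifting) sum.empty)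
qed

instance ..

end

instance pdo :: (diff_algebra) power ..

lift_definition pdo_plus_part :: "'a::zero pdo \<Rightarrow> 'a pdo" is
  "\<lambda>p i. if 0 \<le> i then p i else 0"
  by (metis (full_types))

text \<open>The coefficient of \<open>\<partial>\<^sup>k\<close> in \<open>\<Sum>\<^sub>i (-1)\<^sup>i \<partial>\<^sup>i p\<^sub>i\<close>.\<close>

lift_definition pdo_adjoint :: "'a::diff_algebra pdo \<Rightarrow> 'a pdo" is
  "\<lambda>p k. \<Sum>i \<in> {i. p i \<noteq> 0 \<and> k \<le> i}.
     ((-1) powi i * (real_of_int i gchoose nat (i - k))) *\<^sub>R (dx ^^ nat (i - k)) (p i)"
proof -
  fix p :: "int \<Rightarrow> 'a"
  assume "\<exists>N. \<forall>i>N. p i = 0"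
  then obtain N where N: "\<forall>i>N. p i = 0" by blast
  have "{i. p i \<noteq> 0 \<and> k \<le> i} = {}" if "k > N" for k
    using N that by auto
  then show "\<exists>N. \<forall>k>N. (\<Sum>i \<in> {i. p i \<noteq> 0 \<and> k \<le> i}.
      ((-1) powi i * (real_of_int i gchoose nat (i - k))) *\<^sub>R (dx ^^ nat (i - k)) (p i)) = 0"
    by (intro exI[of _ N]) (metis (no_types, lifting) sum.empty)
qed

text \<open>Coefficientwise \<open>D\<close>; the case distinction is only needed to obtain a total function, as every
  derivation maps \<open>0\<close> to \<open>0\<close>.\<close>

lift_definition pdo_coeff_deriv :: "('a::zero \<Rightarrow> 'a) \<Rightarrow> 'a pdo \<Rightarrow> 'a pdo" is
  "\<lambda>D p i. if p i = 0 then 0 else D (p i)"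
  by (metis (full_types))

text \<open>The action \<open>P(f)\<close> of a differential operator on a function; coefficients of negative powers
  do not enter.\<close>

definition pdo_apply :: "'a::diff_algebra pdo \<Rightarrow> 'a \<Rightarrow> 'a" where
  "pdo_apply P f = (\<Sum>i \<in> {i. pdo_coeff P i \<noteq> 0 \<and> 0 \<le> i}. pdo_coeff P i * (dx ^^ nat i) f)"


section \<open>The 1-constrained CKP hierarchy\<close>

definition cckp_lax :: "'a::diff_algebra \<Rightarrow> 'a \<Rightarrow> 'a pdo" where
  "cckp_lax q r = pdo_monom 1 1
     + pdo_monom q 0 * pdo_monom 1 (-1) * pdo_monom r 0
     + pdo_monom r 0 * pdo_monom 1 (-1) * pdo_monom q 0"

definition cckp_B :: "'a::diff_algebra \<Rightarrow> 'a \<Rightarrow> nat \<Rightarrow> 'a pdo" where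
  "cckp_B q r m = pdo_plus_part (cckp_lax q r ^ m)"

definition cckp_flow :: "(nat \<Rightarrow> 'a::diff_algebra \<Rightarrow> 'a) \<Rightarrow> 'a \<Rightarrow> 'a \<Rightarrow> nat \<Rightarrow> bool" where
  "cckp_flow Dt q r m \<longleftrightarrow>
     pdo_coeff_deriv (Dt m) (cckp_lax q r)
       = cckp_B q r m * cckp_lax q r - cckp_lax q r * cckp_B q r m \<and>
     Dt m q = pdo_apply (cckp_B q r m) q \<and>
     Dt m r = - pdo_apply (pdo_adjoint (cckp_B q r m)) r \<and>
     Dt m r = pdo_apply (cckp_B q r m) r"

definition cckp_hierarchy :: "(nat \<Rightarrow> 'a::diff_algebra \<Rightarrow> 'a) \<Rightarrow> 'a \<Rightarrow> 'a \<Rightarrow> bool" where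
  "cckp_hierarchy Dt q r \<longleftrightarrow> (\<forall>n. cckp_flow Dt q r (2 * n + 1))"


section \<open>The mKdV hierarchy\<close>

text \<open>
  The formal antiderivative in the recursion operator is taken in the free algebra of differential
  polynomials in one indeterminate \<open>u\<close>, where it is unique once the constant term is required to
  vanish.  A monomial is the finitely supported map of the exponents of \<open>u, u\<^sub>x, u\<^sub>x\<^sub>x, \<dots>\<close>, and
  \<open>jet i\<close> is the \<open>i\<close>-th derivative of \<open>u\<close>.
\<close>

type_synonym diff_poly = "(nat \<Rightarrow>\<^sub>0 nat) \<Rightarrow>\<^sub>0 real"

definition jet :: "nat \<Rightarrow> diff_poly" where
  "jet i = Poly_Mapping.single (Poly_Mapping.single i 1) 1"

definition const_dp :: "real \<Rightarrow> diff_poly" where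
  "const_dp c = Poly_Mapping.single 0 c"

text \<open>The derivation \<open>\<Sum>\<^sub>i u\<^sub>i\<^sub>+\<^sub>1 \<partial>/\<partial>u\<^sub>i\<close>, where \<open>u\<^sub>i\<close> is \<open>jet i\<close>.\<close>

definition total_deriv :: "diff_poly \<Rightarrow> diff_poly" where
  "total_deriv P = (\<Sum>a \<in> Poly_Mapping.keys P. \<Sum>i \<in> Poly_Mapping.keys a.
     Poly_Mapping.single
       (a - Poly_Mapping.single i 1 + Poly_Mapping.single (Suc i) 1)
       (Poly_Mapping.lookup P a * real (Poly_Mapping.lookup a i)))"

definition eval_dp :: "diff_poly \<Rightarrow> 'a::diff_algebra \<Rightarrow> 'a" where
  "eval_dp P u = (\<Sum>a \<in> Poly_Mapping.keys P. Poly_Mapping.lookup P a *\<^sub>R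
     (\<Prod>i \<in> Poly_Mapping.keys a. (dx ^^ i) u ^ Poly_Mapping.lookup a i))"

definition formal_antideriv :: "diff_poly \<Rightarrow> diff_poly \<Rightarrow> bool" where
  "formal_antideriv P W \<longleftrightarrow> total_deriv W = P \<and> Poly_Mapping.lookup W 0 = 0"

text \<open>
  \<open>mkdv_rhs m K\<close>: the flow of index \<open>m\<close> is \<open>u\<^bsub>t\<^sub>m\<^esub> = K\<close>. It is a relation because not every
  differential polynomial has an antiderivative; there is at most one such \<open>K\<close>.
\<close>

inductive mkdv_rhs :: "nat \<Rightarrow> diff_poly \<Rightarrow> bool" where
  trivial: "mkdv_rhs 1 (jet 1)"
| recursion: "mkdv_rhs m K \<Longrightarrow> formal_antideriv (jet 0 * K) W \<Longrightarrow>
    mkdv_rhs (m + 2)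
      (total_deriv (total_deriv K) + const_dp (2/3) * jet 0 ^ 2 * K + const_dp (2/3) * jet 1 * W)"

definition mkdv_flow :: "(nat \<Rightarrow> 'a::diff_algebra \<Rightarrow> 'a) \<Rightarrow> 'a \<Rightarrow> nat \<Rightarrow> bool" where
  "mkdv_flow Dt u m \<longleftrightarrow> (\<exists>K. mkdv_rhs m K \<and> Dt m u = eval_dp K u)"

definition mkdv_hierarchy :: "(nat \<Rightarrow> 'a::diff_algebra \<Rightarrow> 'a) \<Rightarrow> 'a \<Rightarrow> bool" where
  "mkdv_hierarchy Dt u \<longleftrightarrow> (\<forall>n. mkdv_flow Dt u (2 * n + 1))"

end

theory Submission
  imports Defs "HOL-Computational_Algebra.Formal_Power_Series"
begin

text \<open>
  For \<open>q = r\<close> and odd \<open>m\<close> put \<open>L = \<partial> + 2 q \<partial>\<^sup>-\<^sup>1 q\<close>, \<open>P = (L\<^sup>m)\<^sub>+\<close> and \<open>f = P(q)\<close>, and let \<open>a\<close> be the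
  residue of \<open>L\<^sup>m\<close>. From \<open>L\<^sup>* = -L\<close> one gets \<open>P\<^sup>* = -P\<close> and hence a division \<open>q P = \<partial> Q - f\<close>.
  Inserting it and its adjoint into \<open>[P, L]\<close>, which has negative order, gives
  \<open>[P, L] = 2 (f \<partial>\<^sup>-\<^sup>1 q + q \<partial>\<^sup>-\<^sup>1 f)\<close>, so that the flow just says \<open>q\<^sub>t = f\<close>, and it shows that
  \<open>S = \<partial> P + 2 q Q\<close> is self-adjoint, hence \<open>q S = \<partial> T + S(q)\<close>. Moreover \<open>a\<^sub>x = 4 q f\<close>,
  \<open>Q(q)\<^sub>x = 2 q f\<close> and \<open>T(q)\<^sub>x = 0\<close>. The differential part of \<open>L \<cdot> L \<cdot> L\<^sup>m\<close> then acts on \<open>q\<close> by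
  \<open>f\<^sub>x\<^sub>x + 8 q\<^sup>2 f + q\<^sub>x (2 Q(q) + a) + 2 q T(q)\<close>.

  For the generic \<open>q\<close> in the algebra of differential polynomials all the functions \<open>a\<close>, \<open>Q(q)\<close>, \<open>T(q)\<close>
  vanish at \<open>u = 0\<close>, and there only constants have derivative \<open>0\<close>; so \<open>T(q) = 0\<close> and
  \<open>a = 2 Q(q) = 4 \<partial>\<^sup>-\<^sup>1(q f)\<close>, which is the mKdV recursion. Evaluation at \<open>u\<close> is a homomorphism of
  differential algebras and transports this to any \<open>q\<close>.
\<close>

section \<open>Derivations\<close>

lemma dx_zero [simp]: "dx (0 :: 'a::diff_algebra) = 0"
  using dx_add[of "0::'a" 0] by simp

lemma dx_one [simp]: "dx (1 :: 'a::diff_algebra) = 0"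
  using dx_mult[of "1::'a" 1] by simp

lemma dx_funpow_add: "(dx ^^ n) (f + g) = (dx ^^ n) f + (dx ^^ n) (g :: 'a::diff_algebra)"
  by (induction n) (simp_all add: dx_add)

lemma dx_funpow_scaleR: "(dx ^^ n) (c *\<^sub>R f) = c *\<^sub>R (dx ^^ n) (f :: 'a::diff_algebra)"
  by (induction n) (simp_all add: dx_scaleR)

lemma dx_funpow_zero [simp]: "(dx ^^ n) (0 :: 'a::diff_algebra) = 0"
  by (induction n) simp_all

lemma dx_funpow_one: "(dx ^^ n) (1 :: 'a::diff_algebra) = (if n = 0 then 1 else 0)"
  by (cases n) (simp_all add: funpow_Suc_right del: funpow.simps)

text \<open>The general Leibniz rule, with the coefficients in the \<open>gchoose\<close> form that
  they have in products of operators.\<close>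

lemma dx_funpow_mult:
  "(dx ^^ n) (f * g) = (\<Sum>a\<le>n. (real n gchoose a) *\<^sub>R ((dx ^^ a) f * (dx ^^ (n - a)) (g :: 'a::diff_algebra)))"
proof (induction n)
  case 0
  show ?case by simp
next
  case (Suc n)
  let ?F = "\<lambda>a. (dx ^^ a) f" and ?G = "\<lambda>a. (dx ^^ a) g"
  have dsum: "dx (sum h A) = (\<Sum>a\<in>A. dx (h a))" if "finite A" for h :: "nat \<Rightarrow> 'a" and A
    using that by (induction A) (simp_all add: dx_add)
  have "(dx ^^ Suc n) (f * g) = (\<Sum>a\<le>n. (real n gchoose a) *\<^sub>R (?F (Suc a) * ?G (n - a)))
      + (\<Sum>a\<le>n. (real n gchoose a) *\<^sub>R (?F a * ?G (Suc n - a)))"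
    by (simp add: Suc dsum dx_scaleR dx_mult scaleR_add_right sum.distrib Suc_diff_le)
  also have "(\<Sum>a\<le>n. (real n gchoose a) *\<^sub>R (?F (Suc a) * ?G (n - a)))
      = (\<Sum>a\<le>Suc n. (if a = 0 then 0 else real n gchoose (a - 1)) *\<^sub>R (?F a * ?G (Suc n - a)))"
    by (subst sum.atMost_Suc_shift) simp
  also have "(\<Sum>a\<le>n. (real n gchoose a) *\<^sub>R (?F a * ?G (Suc n - a)))
      = (\<Sum>a\<le>Suc n. (real n gchoose a) *\<^sub>R (?F a * ?G (Suc n - a)))"
    by (simp add: binomial_gbinomial[symmetric] del: of_nat_Suc)
  also have "(\<Sum>a\<le>Suc n. (if a = 0 then 0 else real n gchoose (a - 1)) *\<^sub>R (?F a * ?G (Suc n - a))) + \<dots>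
      = (\<Sum>a\<le>Suc n. (real (Suc n) gchoose a) *\<^sub>R (?F a * ?G (Suc n - a)))"
    unfolding sum.distrib[symmetric] scaleR_add_left[symmetric]
  proof (intro sum.cong refl arg_cong2[where f = scaleR])
    \<comment> \<open>Pascal's rule; at a = 0 the shifted sum contributes nothing.\<close>
    fix a show "(if a = 0 then 0 else real n gchoose (a - 1)) + (real n gchoose a) = real (Suc n) gchoose a"
      using gbinomial_Suc_Suc[of "real n" "a - 1"] by (cases a) (simp_all add: add.commute)
  qed
  finally show ?case .
qed


section \<open>The ring of pseudo-differential operators\<close>

definition order_le :: "'a::zero pdo \<Rightarrow> int \<Rightarrow> bool" where
  "order_le P N \<longleftrightarrow> (\<forall>i>N. pdo_coeff P i = 0)"

lemma order_le_exists: "\<exists>N. order_le P N"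
  using pdo_coeff[of P] by (auto simp: order_le_def)

lemma order_le_mono: "order_le P N \<Longrightarrow> N \<le> M \<Longrightarrow> order_le P M"
  by (auto simp: order_le_def)

lemma pdo_eqI: "(\<And>i. pdo_coeff P i = pdo_coeff Q i) \<Longrightarrow> P = Q"
  by (metis ext pdo_coeff_inject)

lemma coeff_zero [simp]: "pdo_coeff 0 i = 0"
  by transfer simp

lemma coeff_add [simp]: "pdo_coeff (P + Q) i = pdo_coeff P i + pdo_coeff Q i"
  by transfer simp

lemma coeff_diff [simp]: "pdo_coeff (P - Q) i = pdo_coeff P i - pdo_coeff Q i"
  by transfer simp

lemma coeff_monom: "pdo_coeff (pdo_monom f n) i = (if i = n then f else 0)"
  by transfer simp

lemma order_le_monom: "order_le (pdo_monom f n) n"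
  by (simp add: order_le_def coeff_monom)

instantiation pdo :: (diff_algebra) uminus
begin

lift_definition uminus_pdo :: "'a pdo \<Rightarrow> 'a pdo" is "\<lambda>p i. - p i"
proof -
  fix p :: "int \<Rightarrow> 'a"
  assume "\<exists>N. \<forall>i>N. p i = 0"
  then show "\<exists>N. \<forall>i>N. - p i = 0" by simp
qed

instance ..

end

lemma coeff_minus [simp]: "pdo_coeff (- P) i = - pdo_coeff P i"
  by transfer simp

text \<open>The support of the factors is replaced by an index range that depends on order bounds
  only. Sums for different operators then run over the same indices and can be compared
  termwise.\<close>

lemma coeff_mult:
  assumes "order_le P N" "order_le Q M"
  shows "pdo_coeff (P * Q) k = (\<Sum>i\<in>{k-M..N}. \<Sum>j\<in>{k-i..M}.
    (real_of_int i gchoose nat (i + j - k)) *\<^sub>R (pdo_coeff P i * (dx ^^ nat (i + j - k)) (pdo_coeff Q j)))"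
proof -
  have PN: "i \<le> N" if "pdo_coeff P i \<noteq> 0" for i
    using assms(1) that by (auto simp: order_le_def not_less[symmetric])
  have QM: "j \<le> M" if "pdo_coeff Q j \<noteq> 0" for j
    using assms(2) that by (auto simp: order_le_def not_less[symmetric])
  let ?t = "\<lambda>i j. (real_of_int i gchoose nat (i + j - k)) *\<^sub>R (pdo_coeff P i * (dx ^^ nat (i + j - k)) (pdo_coeff Q j))"
  have "pdo_coeff (P * Q) k = (\<Sum>(i,j)\<in>{(i, j). pdo_coeff P i \<noteq> 0 \<and> pdo_coeff Q j \<noteq> 0 \<and> k \<le> i + j}. ?t i j)"
    by (simp add: times_pdo.rep_eq)
  also have "\<dots> = (\<Sum>(i,j)\<in>Sigma {k-M..N} (\<lambda>i. {k-i..M}). ?t i j)"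
  proof (rule sum.mono_neutral_left)
    show "{(i, j). pdo_coeff P i \<noteq> 0 \<and> pdo_coeff Q j \<noteq> 0 \<and> k \<le> i + j} \<subseteq> Sigma {k-M..N} (\<lambda>i. {k-i..M})"
      using PN QM by fastforce
  qed auto
  also have "\<dots> = (\<Sum>i\<in>{k-M..N}. \<Sum>j\<in>{k-i..M}. ?t i j)"
    by (rule sum.Sigma[symmetric]) auto
  finally show ?thesis .
qed

lemma order_le_mult: "order_le P N \<Longrightarrow> order_le Q M \<Longrightarrow> order_le (P * Q) (N + M)"
  by (subst order_le_def) (auto simp: coeff_mult)

lemma coeff_mult_monom:
  assumes "order_le P N"
  shows "pdo_coeff (P * pdo_monom g j) k = (\<Sum>i\<in>{k-j..N}.
    (real_of_int i gchoose nat (i + j - k)) *\<^sub>R (pdo_coeff P i * (dx ^^ nat (i + j - k)) g))"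
proof -
  have eq: "{i..j} = insert j {i..<j}" if "i \<le> j" for i j :: int using that by auto
  show ?thesis
    unfolding coeff_mult[OF assms order_le_monom]
    by (intro sum.cong refl) (auto simp: coeff_monom eq)
qed

lemma coeff_monom_mult:
  assumes "order_le Q M"
  shows "pdo_coeff (pdo_monom f i * Q) k = (\<Sum>j\<in>{k-i..M}.
    (real_of_int i gchoose nat (i + j - k)) *\<^sub>R (f * (dx ^^ nat (i + j - k)) (pdo_coeff Q j)))"
proof (cases "k - M \<le> i")
  case True
  then have "{k-M..i} = insert i {k-M..<i}" by auto
  then show ?thesis
    unfolding coeff_mult[OF order_le_monom assms]
    by (simp add: coeff_monom)
next
  case False
  then show ?thesis unfolding coeff_mult[OF order_le_monom assms] by simp
qed

lemma coeff_monom_mult_monom: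
  "pdo_coeff (pdo_monom f i * pdo_monom g j) k = (if k \<le> i + j then
    (real_of_int i gchoose nat (i + j - k)) *\<^sub>R (f * (dx ^^ nat (i + j - k)) g) else 0)"
proof (cases "k \<le> i + j")
  case True
  then have "{k-i..j} = insert j {k-i..<j}" by auto
  then show ?thesis
    using True unfolding coeff_monom_mult[OF order_le_monom] by (simp add: coeff_monom)
next
  case False
  then show ?thesis unfolding coeff_monom_mult[OF order_le_monom] by simp
qed

section \<open>Distributivity and the unit\<close>

lemma pdo_distrib_right: "(P + Q) * R = P * R + Q * (R :: 'a::diff_algebra pdo)"
proof -
  obtain N1 N2 M where "order_le P N1" "order_le Q N2" and M: "order_le R M"
    using order_le_exists by metis
  then have N: "order_le P (max N1 N2)" "order_le Q (max N1 N2)" by (auto intro: order_le_mono)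
  then have PQ: "order_le (P + Q) (max N1 N2)" by (simp add: order_le_def)
  show ?thesis
    by (rule pdo_eqI)
      (simp add: coeff_mult[OF PQ M] coeff_mult[OF N(1) M] coeff_mult[OF N(2) M] sum.distrib
        distrib_right scaleR_add_right)
qed

lemma pdo_distrib_left: "R * (P + Q) = R * P + R * (Q :: 'a::diff_algebra pdo)"
proof -
  obtain N1 N2 M where "order_le P N1" "order_le Q N2" and M: "order_le R M"
    using order_le_exists by metis
  then have N: "order_le P (max N1 N2)" "order_le Q (max N1 N2)" by (auto intro: order_le_mono)
  then have PQ: "order_le (P + Q) (max N1 N2)" by (simp add: order_le_def)
  show ?thesis
    by (rule pdo_eqI)
      (simp add: coeff_mult[OF M PQ] coeff_mult[OF M N(1)] coeff_mult[OF M N(2)] sum.distrib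
        distrib_left scaleR_add_right dx_funpow_add)
qed

lemma pdo_one_mult: "1 * P = (P :: 'a::diff_algebra pdo)"
proof -
  obtain M where M: "order_le P M" using order_le_exists by blast
  show ?thesis
  proof (rule pdo_eqI)
    fix k
    have "pdo_coeff (1 * P) k = (\<Sum>j\<in>{k..M}. (0 gchoose nat (j - k)) *\<^sub>R (dx ^^ nat (j - k)) (pdo_coeff P j))"
      by (simp add: one_pdo_def coeff_monom_mult[OF M])
    also have "\<dots> = (\<Sum>j\<in>{k..M}. if j = k then pdo_coeff P k else 0)"
      by (rule sum.cong) (auto simp: gbinomial_0_left)
    also have "\<dots> = pdo_coeff P k" using M by (auto simp: order_le_def)
    finally show "pdo_coeff (1 * P) k = pdo_coeff P k" .
  qed
qed

lemma pdo_mult_one: "P * 1 = (P :: 'a::diff_algebra pdo)"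
proof -
  obtain M where M: "order_le P M" using order_le_exists by blast
  show ?thesis
  proof (rule pdo_eqI)
    fix k
    have "pdo_coeff (P * 1) k = (\<Sum>i\<in>{k..M}. if i = k then pdo_coeff P k else 0)"
      unfolding one_pdo_def coeff_mult_monom[OF M]
      by (rule sum.cong) (auto simp: dx_funpow_one)
    also have "\<dots> = pdo_coeff P k" using M by (auto simp: order_le_def)
    finally show "pdo_coeff (P * 1) k = pdo_coeff P k" .
  qed
qed

text \<open>
  Maps of this kind are continuous for the order filtration, so they are determined by their values
  on monomials; this is how identities with infinite sums are reduced to finite ones below.
\<close>

definition filtered_additive :: "('a::diff_algebra pdo \<Rightarrow> 'b::diff_algebra pdo) \<Rightarrow> bool" where
  "filtered_additive F \<longleftrightarrow> (\<forall>X Y. F (X + Y) = F X + F Y) \<and>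
     (\<exists>d. \<forall>K X. order_le X K \<longrightarrow> order_le (F X) (K + d))"

lemma filtered_additive_ident: "filtered_additive (\<lambda>X. X)"
  unfolding filtered_additive_def by (auto intro!: exI[of _ 0])

lemma filtered_additive_compose:
  "filtered_additive F \<Longrightarrow> filtered_additive G \<Longrightarrow> filtered_additive (\<lambda>X. F (G X))"
  unfolding filtered_additive_def by (metis add.assoc)

lemma filtered_additive_mult_left: "filtered_additive F \<Longrightarrow> filtered_additive (\<lambda>X. P * F X)"
proof -
  obtain N where "order_le P N" using order_le_exists by blast
  then have "filtered_additive (\<lambda>X. P * X)"
    unfolding filtered_additive_def by (metis pdo_distrib_left order_le_mult add.commute)
  then show "filtered_additive F \<Longrightarrow> filtered_additive (\<lambda>X. P * F X)"
    by (rule filtered_additive_compose)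
qed

lemma filtered_additive_mult_right: "filtered_additive F \<Longrightarrow> filtered_additive (\<lambda>X. F X * P)"
proof -
  obtain N where "order_le P N" using order_le_exists by blast
  then have "filtered_additive (\<lambda>X. X * P)"
    unfolding filtered_additive_def by (metis pdo_distrib_right order_le_mult)
  then show "filtered_additive F \<Longrightarrow> filtered_additive (\<lambda>X. F X * P)"
    by (rule filtered_additive_compose)
qed

lemma filtered_additive_minus: "filtered_additive F \<Longrightarrow> filtered_additive (\<lambda>X. - F X)"
proof -
  have "filtered_additive (\<lambda>X :: 'b pdo. - X)"
    unfolding filtered_additive_def
    by (auto simp: order_le_def intro!: exI[of _ 0] pdo_eqI)
  then show "filtered_additive F \<Longrightarrow> filtered_additive (\<lambda>X. - F X)"
    by (rule filtered_additive_compose)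
qed

lemmas filtered_additive_intros = filtered_additive_ident filtered_additive_mult_left
  filtered_additive_mult_right filtered_additive_minus

text \<open>A fixed coefficient of the image sees only finitely many leading terms of X. Those are
  peeled off one monomial at a time, and what is left has too low an order to matter.\<close>

lemma filtered_additive_eqI:
  assumes "filtered_additive F" "filtered_additive G"
    and monom: "\<And>f i. F (pdo_monom f i) = G (pdo_monom f i)"
  shows "F X = G X"
proof (rule pdo_eqI)
  fix n
  obtain d where d: "\<And>K X. order_le X K \<Longrightarrow> order_le (F X) (K + d)"
    using assms(1) by (auto simp: filtered_additive_def)
  obtain e where e: "\<And>K X. order_le X K \<Longrightarrow> order_le (G X) (K + e)"
    using assms(2) by (auto simp: filtered_additive_def)
  \<comment> \<open>Operators of order at most K have images of order at most n - 1 under both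
    maps.\<close>
  define K where "K = n - 1 - max d e"
  have low: "pdo_coeff (F X) n = pdo_coeff (G X) n" if "order_le X N" "N \<le> K" for X N
    using d[OF that(1)] e[OF that(1)] that(2) by (auto simp: order_le_def K_def)
  have "pdo_coeff (F X) n = pdo_coeff (G X) n" if "order_le X (K + int l)" for X l
    using that
  proof (induction l arbitrary: X)
    case 0
    then show ?case using low by simp
  next
    case (Suc l)
    define Y where "Y = X - pdo_monom (pdo_coeff X (K + int (Suc l))) (K + int (Suc l))"
    have X: "X = Y + pdo_monom (pdo_coeff X (K + int (Suc l))) (K + int (Suc l))"
      unfolding Y_def by (rule pdo_eqI) simp
    have "order_le Y (K + int l)"
      using Suc.prems by (auto simp: order_le_def Y_def coeff_monom)
    then have "pdo_coeff (F Y) n = pdo_coeff (G Y) n" by (rule Suc.IH)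
    moreover have "F X = F Y + F (pdo_monom (pdo_coeff X (K + int (Suc l))) (K + int (Suc l)))"
      using assms(1) by (subst X) (simp add: filtered_additive_def)
    moreover have "G X = G Y + G (pdo_monom (pdo_coeff X (K + int (Suc l))) (K + int (Suc l)))"
      using assms(2) by (subst X) (simp add: filtered_additive_def)
    ultimately show ?case by (simp add: monom)
  qed
  moreover obtain N where "order_le X N" using order_le_exists by blast
  then have "order_le X (K + int (nat (N - K)))" by (rule order_le_mono) simp
  ultimately show "pdo_coeff (F X) n = pdo_coeff (G X) n" by blast
qed

text \<open>Both sides are combinations of the terms p q^(a) r^(m-a), where (a) counts derivatives;
  equality of the coefficients is a binomial identity.\<close>

lemma pdo_assoc_monom:
  "pdo_monom p i * pdo_monom q j * pdo_monom r k = pdo_monom p i * (pdo_monom q j * pdo_monom (r :: 'a::diff_algebra) k)"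
proof (rule pdo_eqI)
  fix n
  have o1: "order_le (pdo_monom p i * pdo_monom q j) (i + j)"
    and o2: "order_le (pdo_monom q j * pdo_monom r k) (j + k)"
    by (intro order_le_mult order_le_monom)+
  show "pdo_coeff (pdo_monom p i * pdo_monom q j * pdo_monom r k) n
      = pdo_coeff (pdo_monom p i * (pdo_monom q j * pdo_monom r k)) n"
  proof (cases "n \<le> i + j + k")
    case False
    then show ?thesis
      by (simp add: coeff_mult_monom[OF o1] coeff_monom_mult[OF o2])
  next
    case True
    \<comment> \<open>Here m is the total number of derivatives that fall on q and r in each term of
      order n.\<close>
    then obtain m where m: "i + j + k - n = int m" by (metis diff_ge_0_iff_ge nonneg_int_cases)
    let ?q = "\<lambda>a. (dx ^^ a) q" and ?r = "\<lambda>a. (dx ^^ a) r"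
    have left_index: "nat (a + k - n) = m - nat (i + j - a)" if "n - k \<le> a" "a \<le> i + j" for a
      using m that by linarith
    have right_index: "nat (i + b - n) = m - nat (j + k - b)" if "n - i \<le> b" "b \<le> j + k" for b
      using m that by linarith
    have "pdo_coeff (pdo_monom p i * pdo_monom q j * pdo_monom r k) n
      = (\<Sum>l\<le>m. (real_of_int (i + j - int l) gchoose (m - l)) *\<^sub>R
          ((real_of_int i gchoose l) *\<^sub>R (p * ?q l) * ?r (m - l)))"
      unfolding coeff_mult_monom[OF o1] coeff_monom_mult_monom
      by (rule sum.reindex_bij_witness[where i = "\<lambda>l. i + j - int l" and j = "\<lambda>a. nat (i + j - a)"])
        (use m in \<open>auto simp: left_index\<close>)
    also have "\<dots> = (\<Sum>l\<le>m. ((real_of_int i gchoose l) * (real_of_int (i + j - int l) gchoose (m - l))) *\<^sub>R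
          (p * (?q l * ?r (m - l))))"
      by (simp add: algebra_simps)
    finally have left: "pdo_coeff (pdo_monom p i * pdo_monom q j * pdo_monom r k) n = \<dots>" .
    \<comment> \<open>Of the derivatives in the power j, s fall on r; of those in the power i, m - s
      fall on the product of q and r^(s), and a of these hit q.\<close>
    let ?c = "\<lambda>s a. (real_of_int i gchoose (m - s)) * (real_of_int j gchoose s) * (real (m - s) gchoose a)"
    have "pdo_coeff (pdo_monom p i * (pdo_monom q j * pdo_monom r k)) n
      = (\<Sum>s\<le>m. (real_of_int i gchoose (m - s)) *\<^sub>R (p *
          (dx ^^ (m - s)) ((real_of_int j gchoose s) *\<^sub>R (q * ?r s))))"
      unfolding coeff_monom_mult[OF o2] coeff_monom_mult_monom
      by (rule sum.reindex_bij_witness[where i = "\<lambda>l. j + k - int l" and j = "\<lambda>a. nat (j + k - a)"])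
        (use m in \<open>auto simp: right_index\<close>)
    also have "\<dots> = (\<Sum>s\<le>m. \<Sum>a\<in>{a. a \<in> {..m} \<and> a + s \<le> m}. ?c s a *\<^sub>R (p * (?q a * ?r (m - a))))"
    proof (rule sum.cong[OF refl])
      fix s assume "s \<in> {..m}"
      then have s: "{a. a \<in> {..m} \<and> a + s \<le> m} = {..m - s}" by auto
      have r: "(dx ^^ (m - s - a)) (?r s) = ?r (m - a)" if "a \<le> m - s" for a
      proof -
        have "m - a = (m - s - a) + s" using that \<open>s \<in> {..m}\<close> by auto
        then show ?thesis by (simp only: funpow_add comp_apply)
      qed
      show "(real_of_int i gchoose (m - s)) *\<^sub>R (p *
          (dx ^^ (m - s)) ((real_of_int j gchoose s) *\<^sub>R (q * ?r s)))
        = (\<Sum>a\<in>{a. a \<in> {..m} \<and> a + s \<le> m}. ?c s a *\<^sub>R (p * (?q a * ?r (m - a))))"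
        unfolding s by (simp add: dx_funpow_scaleR dx_funpow_mult scaleR_sum_right sum_distrib_left r[simplified] mult.assoc)
    qed
    also have "\<dots> = (\<Sum>a\<le>m. \<Sum>s\<in>{s. s \<in> {..m} \<and> a + s \<le> m}. ?c s a *\<^sub>R (p * (?q a * ?r (m - a))))"
      by (rule sum.swap_restrict) auto
    also have "\<dots> = (\<Sum>a\<le>m. ((real_of_int i gchoose a) * (real_of_int (i + j - int a) gchoose (m - a))) *\<^sub>R
          (p * (?q a * ?r (m - a))))"
    proof (rule sum.cong[OF refl])
      fix a assume "a \<in> {..m}"
      then have a: "{s. s \<in> {..m} \<and> a + s \<le> m} = {0..m - a}" by auto
      \<comment> \<open>Trinomial revision pulls out the factor free of s; what remains is a
        Vandermonde convolution with upper arguments j and i - a.\<close>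
      have "(\<Sum>s\<in>{0..m - a}. ?c s a)
        = (\<Sum>s\<in>{0..m - a}. (real_of_int i gchoose a) * ((real_of_int j gchoose s) * (real_of_int i - real a gchoose (m - a - s))))"
      proof (rule sum.cong[OF refl])
        fix s assume "s \<in> {0..m - a}"
        with \<open>a \<in> {..m}\<close> have "a \<le> m - s" by auto
        from gbinomial_trinomial_revision[OF this, of "real_of_int i"]
        show "?c s a = (real_of_int i gchoose a) * ((real_of_int j gchoose s) * (real_of_int i - real a gchoose (m - a - s)))"
          by (simp add: algebra_simps)
      qed
      also have "\<dots> = (real_of_int i gchoose a) * (real_of_int (i + j - int a) gchoose (m - a))"
        unfolding sum_distrib_left[symmetric] gbinomial_Vandermonde by (simp add: algebra_simps)
      finally show "(\<Sum>s\<in>{s. s \<in> {..m} \<and> a + s \<le> m}. ?c s a *\<^sub>R (p * (?q a * ?r (m - a))))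
        = ((real_of_int i gchoose a) * (real_of_int (i + j - int a) gchoose (m - a))) *\<^sub>R (p * (?q a * ?r (m - a)))"
        unfolding a scaleR_sum_left[symmetric] by simp
    qed
    finally show ?thesis using left by simp
  qed
qed

instance pdo :: (diff_algebra) ring_1
proof
  fix P Q R :: "'a pdo"
  show "P + Q + R = P + (Q + R)" "P + Q = Q + P" "0 + P = P" "- P + P = 0" "P - Q = P + - Q"
    by (rule pdo_eqI; simp)+
  show "1 * P = P" "P * 1 = P" by (fact pdo_one_mult pdo_mult_one)+
  show "(P + Q) * R = P * R + Q * R" "P * (Q + R) = P * Q + P * R"
    by (fact pdo_distrib_right pdo_distrib_left)+
  show "(0 :: 'a pdo) \<noteq> 1"
    by (metis coeff_monom coeff_zero one_pdo_def zero_neq_one)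
  \<comment> \<open>Associativity is extended from monomials to arbitrary operators one factor at a
    time, starting with the rightmost.\<close>
  have 1: "pdo_monom f i * pdo_monom g j * R = pdo_monom f i * (pdo_monom g j * R)" for f g :: 'a and i j
    by (rule filtered_additive_eqI) (intro filtered_additive_intros, intro filtered_additive_intros, rule pdo_assoc_monom)
  have 2: "pdo_monom f i * Q * R = pdo_monom f i * (Q * R)" for f :: 'a and i
    by (rule filtered_additive_eqI) (intro filtered_additive_intros, intro filtered_additive_intros, rule 1)
  show "P * Q * R = P * (Q * R)"
    by (rule filtered_additive_eqI) (intro filtered_additive_intros, intro filtered_additive_intros, rule 2)
qed

section \<open>Adjoints and division\<close>

abbreviation pdo_fun :: "'a::diff_algebra \<Rightarrow> 'a pdo" where
  "pdo_fun f \<equiv> pdo_monom f 0"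

abbreviation pdo_D :: "'a::diff_algebra pdo" where
  "pdo_D \<equiv> pdo_monom 1 1"

abbreviation pdo_I :: "'a::diff_algebra pdo" where
  "pdo_I \<equiv> pdo_monom 1 (-1)"

lemma order_le_add: "order_le P N \<Longrightarrow> order_le Q N \<Longrightarrow> order_le (P + Q :: 'a::diff_algebra pdo) N"
  and order_le_diff: "order_le P N \<Longrightarrow> order_le Q N \<Longrightarrow> order_le (P - Q :: 'a::diff_algebra pdo) N"
  by (simp_all add: order_le_def)

lemma order_le_mult_le: "order_le P N \<Longrightarrow> order_le Q M \<Longrightarrow> N + M \<le> K \<Longrightarrow> order_le (P * Q) K"
  using order_le_mult order_le_mono by blast

lemma pdo_monom_add: "pdo_monom (f + g) i = pdo_monom f i + pdo_monom (g :: 'a::diff_algebra) i"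
  and pdo_monom_minus: "pdo_monom (- f) i = - pdo_monom (f :: 'a::diff_algebra) i"
  by (rule pdo_eqI; simp add: coeff_monom)+

lemma pdo_monom_mult_D: "pdo_monom f i * pdo_monom 1 j = pdo_monom (f :: 'a::diff_algebra) (i + j)"
  by (rule pdo_eqI) (auto simp: coeff_monom_mult_monom coeff_monom dx_funpow_one)

lemma pdo_D_mult_I [simp]: "pdo_D * pdo_I = (1 :: 'a::diff_algebra pdo)"
  and pdo_I_mult_D [simp]: "pdo_I * pdo_D = (1 :: 'a::diff_algebra pdo)"
  by (simp_all add: pdo_monom_mult_D one_pdo_def)

lemma pdo_fun_mult_monom: "pdo_fun f * pdo_monom g j = pdo_monom (f * g :: 'a::diff_algebra) j"
  by (rule pdo_eqI) (auto simp: coeff_monom_mult_monom coeff_monom gbinomial_0_left)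

lemma coeff_fun_mult: "pdo_coeff (pdo_fun f * P) k = f * pdo_coeff P k"
proof -
  obtain M where M: "order_le P M" using order_le_exists by blast
  have "pdo_coeff (pdo_fun f * P) k = (\<Sum>j\<in>{k..M}. if j = k then f * pdo_coeff P k else 0)"
    unfolding coeff_monom_mult[OF M]
    by (rule sum.cong) (auto simp: gbinomial_0_left)
  also have "\<dots> = f * pdo_coeff P k" using M by (auto simp: order_le_def)
  finally show ?thesis .
qed

lemma coeff_mult_D: "pdo_coeff (P * pdo_monom 1 j) k = pdo_coeff P (k - j)"
proof -
  obtain M where M: "order_le P M" using order_le_exists by blast
  have "pdo_coeff (P * pdo_monom 1 j) k = (\<Sum>i\<in>{k-j..M}. if i = k - j then pdo_coeff P (k - j) else 0)"
    unfolding coeff_mult_monom[OF M]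
    by (rule sum.cong) (auto simp: dx_funpow_one)
  also have "\<dots> = pdo_coeff P (k - j)" using M by (auto simp: order_le_def)
  finally show ?thesis .
qed

lemma coeff_D_mult: "pdo_coeff (pdo_D * P) k = pdo_coeff P (k - 1) + dx (pdo_coeff P k)"
proof -
  obtain M0 where "order_le P M0" using order_le_exists by blast
  \<comment> \<open>The bound is raised to at least k, so that the two indices with nonzero
    binomials, k - 1 and k, both lie in the range.\<close>
  then have M: "order_le P (max k M0)" by (rule order_le_mono) simp
  have split: "{k - 1..max k M0} = insert (k - 1) (insert k {k + 1..max k M0})" by auto
  have "(\<Sum>j\<in>{k + 1..max k M0}. (1 gchoose nat (1 + j - k)) *\<^sub>R (dx ^^ nat (1 + j - k)) (pdo_coeff P j)) = 0"
  proof (rule sum.neutral, rule ballI)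
    fix j assume "j \<in> {k + 1..max k M0}"
    then have "1 < nat (1 + j - k)" by auto
    then show "(1 gchoose nat (1 + j - k)) *\<^sub>R (dx ^^ nat (1 + j - k)) (pdo_coeff P j) = 0"
      using binomial_gbinomial[of 1 "nat (1 + j - k)", where 'a = real] by (simp add: binomial_eq_0)
  qed
  then show ?thesis
    unfolding coeff_monom_mult[OF M] split by simp
qed

lemma pdo_D_mult_fun: "pdo_D * pdo_fun f = pdo_fun f * pdo_D + pdo_fun (dx f)"
  by (rule pdo_eqI) (auto simp: coeff_D_mult coeff_mult_D coeff_monom)

text \<open>In the product with a function, order 0 is reached only when all derivatives hit f, with
  binomial coefficient 1. The action on functions thus becomes part of the ring calculus.\<close>

lemma pdo_apply_eq_coeff: "pdo_apply P f = pdo_coeff (P * pdo_fun f) 0"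
proof -
  obtain M where M: "order_le P M" using order_le_exists by blast
  have g: "real_of_int i gchoose nat i = 1" if "0 \<le> i" for i
    using that binomial_gbinomial[of "nat i" "nat i", where 'a = real] by simp
  have "pdo_apply P f = (\<Sum>i\<in>{0..M}. pdo_coeff P i * (dx ^^ nat i) f)"
    unfolding pdo_apply_def
    by (rule sum.mono_neutral_left) (use M in \<open>auto simp: order_le_def not_less[symmetric]\<close>)
  also have "\<dots> = pdo_coeff (P * pdo_fun f) 0"
    unfolding coeff_mult_monom[OF M] by (rule sum.cong) (auto simp: g)
  finally show ?thesis .
qed

section \<open>Differential operators and differential parts\<close>

definition is_diff_op :: "'a::zero pdo \<Rightarrow> bool" where
  "is_diff_op P \<longleftrightarrow> (\<forall>i<0. pdo_coeff P i = 0)"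

lemma is_diff_op_add: "is_diff_op P \<Longrightarrow> is_diff_op Q \<Longrightarrow> is_diff_op (P + Q :: 'a::diff_algebra pdo)"
  and is_diff_op_diff: "is_diff_op P \<Longrightarrow> is_diff_op Q \<Longrightarrow> is_diff_op (P - Q :: 'a::diff_algebra pdo)"
  and is_diff_op_minus: "is_diff_op P \<Longrightarrow> is_diff_op (- P :: 'a::diff_algebra pdo)"
  by (simp_all add: is_diff_op_def)

lemma is_diff_op_monom: "0 \<le> n \<Longrightarrow> is_diff_op (pdo_monom f n)"
  by (simp add: is_diff_op_def coeff_monom)

lemma gbinomial_int_eq_0:
  assumes "0 \<le> i" "i < int n"
  shows "real_of_int i gchoose n = 0"
  using assms binomial_gbinomial[of "nat i" n, where 'a = real] by (simp add: binomial_eq_0)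

lemma is_diff_op_mult:
  assumes "is_diff_op P" "is_diff_op Q"
  shows "is_diff_op (P * Q)"
  unfolding is_diff_op_def
proof (intro allI impI)
  fix k :: int assume k: "k < 0"
  obtain N M where *: "order_le P N" "order_le Q M" using order_le_exists by metis
  show "pdo_coeff (P * Q) k = 0"
    unfolding coeff_mult[OF *]
  proof (intro sum.neutral ballI)
    fix i j assume "i \<in> {k - M..N}" "j \<in> {k - i..M}"
    show "(real_of_int i gchoose nat (i + j - k)) *\<^sub>R
      (pdo_coeff P i * (dx ^^ nat (i + j - k)) (pdo_coeff Q j)) = 0"
    proof (cases "0 \<le> i \<and> 0 \<le> j")
      case True
      then have "real_of_int i gchoose nat (i + j - k) = 0" using k by (intro gbinomial_int_eq_0) auto
      then show ?thesis by simp
    qed (use assms in \<open>auto simp: is_diff_op_def\<close>)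
  qed
qed

lemmas is_diff_op_intros = is_diff_op_add is_diff_op_diff is_diff_op_minus is_diff_op_mult

lemma coeff_plus_part: "pdo_coeff (pdo_plus_part P) i = (if 0 \<le> i then pdo_coeff P i else 0)"
  by transfer simp

lemma is_diff_op_plus_part: "is_diff_op (pdo_plus_part P)"
  by (simp add: is_diff_op_def coeff_plus_part)

lemma order_le_minus_part: "order_le (P - pdo_plus_part P :: 'a::diff_algebra pdo) (-1)"
  by (simp add: order_le_def coeff_plus_part)

lemma plus_part_eqI:
  assumes "is_diff_op X" "order_le (P - X) (-1)"
  shows "pdo_plus_part P = (X :: 'a::diff_algebra pdo)"
  using assms by (intro pdo_eqI) (auto simp: coeff_plus_part is_diff_op_def order_le_def)

lemma is_diff_op_order_0:
  assumes "is_diff_op P" "order_le P 0"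
  shows "P = pdo_fun (pdo_coeff P 0)"
  using assms by (intro pdo_eqI) (auto simp: coeff_monom is_diff_op_def order_le_def neq_iff)

lemma is_diff_op_negative_order:
  assumes "is_diff_op P" "order_le P (-1)"
  shows "P = (0 :: 'a::diff_algebra pdo)"
proof (rule pdo_eqI)
  show "pdo_coeff P i = pdo_coeff 0 i" for i
    using assms by (cases "i < 0") (auto simp: is_diff_op_def order_le_def)
qed

text \<open>For a general operator the coefficient at -1 would also be shifted into order 0; a
  differential operator has none.\<close>

lemma coeff_D_mult_fun:
  assumes "is_diff_op P"
  shows "pdo_coeff (pdo_D * P * pdo_fun f) 0 = dx (pdo_apply P f)"
  using is_diff_op_mult[OF assms is_diff_op_monom[of 0 f]]
  by (simp add: mult.assoc coeff_D_mult pdo_apply_eq_coeff is_diff_op_def)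

section \<open>The formal adjoint\<close>

lemma coeff_adjoint:
  assumes "order_le P N"
  shows "pdo_coeff (pdo_adjoint P) k = (\<Sum>i\<in>{k..N}.
    ((-1) powi i * (real_of_int i gchoose nat (i - k))) *\<^sub>R (dx ^^ nat (i - k)) (pdo_coeff P i))"
  unfolding pdo_adjoint.rep_eq
  by (rule sum.mono_neutral_left) (use assms in \<open>auto simp: order_le_def not_less[symmetric]\<close>)

lemma pdo_adjoint_add: "pdo_adjoint (P + Q) = pdo_adjoint P + pdo_adjoint (Q :: 'a::diff_algebra pdo)"
proof -
  obtain N1 N2 where "order_le P N1" "order_le Q N2"
    using order_le_exists by metis
  then have N: "order_le P (max N1 N2)" "order_le Q (max N1 N2)" by (auto intro: order_le_mono)
  then have PQ: "order_le (P + Q) (max N1 N2)" by (simp add: order_le_def)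
  show ?thesis
    by (rule pdo_eqI) (simp add: coeff_adjoint[OF N(1)] coeff_adjoint[OF N(2)] coeff_adjoint[OF PQ]
        dx_funpow_add scaleR_add_right sum.distrib)
qed

lemma filtered_additive_adjoint: "filtered_additive F \<Longrightarrow> filtered_additive (\<lambda>X. pdo_adjoint (F X))"
proof -
  have "filtered_additive (\<lambda>X :: 'b pdo. pdo_adjoint X)"
    unfolding filtered_additive_def
    by (auto simp: order_le_def coeff_adjoint pdo_adjoint_add intro!: exI[of _ 0])
  then show "filtered_additive F \<Longrightarrow> filtered_additive (\<lambda>X. pdo_adjoint (F X))"
    by (rule filtered_additive_compose)
qed

lemma pdo_adjoint_minus: "pdo_adjoint (- P) = - pdo_adjoint (P :: 'a::diff_algebra pdo)"
proof -
  have "pdo_adjoint P + pdo_adjoint (- P) = pdo_adjoint 0"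
    by (simp flip: pdo_adjoint_add)
  also have "\<dots> = 0" using pdo_adjoint_add[of "0 :: 'a pdo" 0] by simp
  finally show ?thesis by (simp add: add_eq_0_iff)
qed

lemma pdo_adjoint_diff: "pdo_adjoint (P - Q) = pdo_adjoint P - pdo_adjoint (Q :: 'a::diff_algebra pdo)"
  using pdo_adjoint_add[of P "- Q"] by (simp add: pdo_adjoint_minus)

lemma pdo_adjoint_monom:
  "pdo_adjoint (pdo_monom f i) = (if even i then pdo_monom 1 i * pdo_fun f else - (pdo_monom 1 i * pdo_fun f))"
proof -
  have "{k..i} = insert i {k..<i}" if "k \<le> i" for k using that by auto
  then show ?thesis
    by (intro pdo_eqI) (auto simp: coeff_adjoint[OF order_le_monom] coeff_monom_mult_monom coeff_monom)
qed

lemma pdo_adjoint_fun [simp]: "pdo_adjoint (pdo_fun f) = pdo_fun f"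
  by (simp add: pdo_adjoint_monom pdo_fun_mult_monom)

lemma pdo_adjoint_one [simp]: "pdo_adjoint 1 = (1 :: 'a::diff_algebra pdo)"
  by (simp add: one_pdo_def)

lemma pdo_adjoint_D [simp]: "pdo_adjoint pdo_D = - (pdo_D :: 'a::diff_algebra pdo)"
  and pdo_adjoint_I [simp]: "pdo_adjoint pdo_I = - (pdo_I :: 'a::diff_algebra pdo)"
  by (simp_all add: pdo_adjoint_monom pdo_monom_mult_D)

lemma pdo_adjoint_fun_mult: "pdo_adjoint (pdo_fun f * X) = pdo_adjoint X * pdo_fun f"
proof (rule filtered_additive_eqI[where X = X])
  show "filtered_additive (\<lambda>X. pdo_adjoint (pdo_fun f * X))"
    "filtered_additive (\<lambda>X. pdo_adjoint X * pdo_fun f)"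
    by (intro filtered_additive_adjoint filtered_additive_intros)+
  show "pdo_adjoint (pdo_fun f * pdo_monom g i) = pdo_adjoint (pdo_monom g i) * pdo_fun f" for g i
    by (simp add: pdo_fun_mult_monom pdo_adjoint_monom mult.assoc) (simp add: mult.commute)
qed

lemma pdo_adjoint_D_mult: "pdo_adjoint (pdo_D * X) = - (pdo_adjoint X * (pdo_D :: 'a::diff_algebra pdo))"
proof (rule filtered_additive_eqI[where X = X])
  show "filtered_additive (\<lambda>X :: 'a pdo. pdo_adjoint (pdo_D * X))"
    "filtered_additive (\<lambda>X :: 'a pdo. - (pdo_adjoint X * pdo_D))"
    by (intro filtered_additive_adjoint filtered_additive_intros)+
  fix f :: 'a and i
  have "pdo_D * pdo_monom f i = pdo_monom f (i + 1) + pdo_monom (dx f) i"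
    by (rule pdo_eqI) (auto simp: coeff_D_mult coeff_monom)
  moreover have "pdo_monom 1 (i + 1) = pdo_monom 1 i * (pdo_D :: 'a pdo)"
    by (simp add: pdo_monom_mult_D)
  ultimately show "pdo_adjoint (pdo_D * pdo_monom f i) = - (pdo_adjoint (pdo_monom f i) * pdo_D)"
    by (simp add: pdo_adjoint_add pdo_adjoint_monom mult.assoc pdo_D_mult_fun distrib_left)
qed

text \<open>Follows from the rule for \<open>pdo_D\<close>, whose inverse is \<open>pdo_I\<close>;
  no infinite expansion has to be compared.\<close>

lemma pdo_adjoint_I_mult: "pdo_adjoint (pdo_I * X) = - (pdo_adjoint X * (pdo_I :: 'a::diff_algebra pdo))"
proof -
  have "pdo_adjoint X = - (pdo_adjoint (pdo_I * X) * pdo_D)"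
    using pdo_adjoint_D_mult[of "pdo_I * X"] by (simp flip: mult.assoc)
  then have "pdo_adjoint X * pdo_I = - pdo_adjoint (pdo_I * X)" by (simp add: mult.assoc)
  then show ?thesis by simp
qed

text \<open>A monomial is a function times a power of \<partial>, and the powers arise from
  \<open>pdo_D\<close> and \<open>pdo_I\<close> by induction on the exponent in both directions from
  0.\<close>

lemma pdo_adjoint_monom_mult: "pdo_adjoint (pdo_monom f i * X) = pdo_adjoint X * pdo_adjoint (pdo_monom f i)"
proof -
  have *: "pdo_adjoint (pdo_monom (1 :: 'a) i * X) = pdo_adjoint X * pdo_adjoint (pdo_monom 1 i)" for X
  proof (induction i arbitrary: X rule: int_induct[where k = 0])
    case base
    then show ?case by (simp flip: one_pdo_def)
  next
    case (step1 i)
    have "pdo_monom 1 (i + 1) = pdo_monom 1 i * (pdo_D :: 'a pdo)" by (simp add: pdo_monom_mult_D)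
    then show ?case by (simp add: mult.assoc step1 pdo_adjoint_D_mult)
  next
    case (step2 i)
    have "pdo_monom 1 (i - 1) = pdo_monom 1 i * (pdo_I :: 'a pdo)" by (simp add: pdo_monom_mult_D)
    then show ?case by (simp add: mult.assoc step2 pdo_adjoint_I_mult)
  qed
  have "pdo_monom f i = pdo_fun f * pdo_monom 1 i" by (simp add: pdo_fun_mult_monom)
  then show ?thesis by (simp add: mult.assoc pdo_adjoint_fun_mult *)
qed

lemma pdo_adjoint_mult: "pdo_adjoint (P * Q) = pdo_adjoint Q * pdo_adjoint (P :: 'a::diff_algebra pdo)"
  by (rule filtered_additive_eqI)
    (intro filtered_additive_adjoint filtered_additive_intros,
     intro filtered_additive_adjoint filtered_additive_intros, rule pdo_adjoint_monom_mult)

lemma pdo_adjoint_power: "pdo_adjoint (P ^ n) = pdo_adjoint P ^ n"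
  by (induction n) (simp_all add: pdo_adjoint_mult power_commutes)

lemma is_diff_op_adjoint:
  assumes "is_diff_op P"
  shows "is_diff_op (pdo_adjoint P)"
  unfolding is_diff_op_def
proof (intro allI impI)
  fix k :: int assume k: "k < 0"
  obtain N where N: "order_le P N" using order_le_exists by metis
  show "pdo_coeff (pdo_adjoint P) k = 0"
    unfolding coeff_adjoint[OF N]
  proof (intro sum.neutral ballI)
    fix i assume "i \<in> {k..N}"
    show "((-1) powi i * (real_of_int i gchoose nat (i - k))) *\<^sub>R (dx ^^ nat (i - k)) (pdo_coeff P i) = 0"
    proof (cases "0 \<le> i")
      case True
      then have "real_of_int i gchoose nat (i - k) = 0" using k by (intro gbinomial_int_eq_0) auto
      then show ?thesis by simp
    qed (use assms in \<open>auto simp: is_diff_op_def\<close>)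
  qed
qed

lemma order_le_adjoint: "order_le P N \<Longrightarrow> order_le (pdo_adjoint P) N"
  by (subst order_le_def) (simp add: coeff_adjoint)

text \<open>The adjoint preserves differential operators as well as operators of negative
  order.\<close>

lemma plus_part_adjoint: "pdo_plus_part (pdo_adjoint P) = pdo_adjoint (pdo_plus_part P)"
proof (rule plus_part_eqI)
  show "is_diff_op (pdo_adjoint (pdo_plus_part P))"
    by (intro is_diff_op_adjoint is_diff_op_plus_part)
  show "order_le (pdo_adjoint P - pdo_adjoint (pdo_plus_part P)) (-1)"
    unfolding pdo_adjoint_diff[symmetric] by (intro order_le_adjoint order_le_minus_part)
qed

text \<open>Division of X by \<partial> from the left leaves a function c, with X = \<partial> T +
  c. In the adjoint, T contributes only terms ending in \<partial>, so c is the zeroth coefficient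
  there.\<close>

lemma pdo_left_division:
  assumes "is_diff_op X"
  shows "pdo_I * X = pdo_plus_part (pdo_I * X) + pdo_I * pdo_fun (pdo_coeff (pdo_adjoint X) 0)"
proof -
  define T where "T = pdo_plus_part (pdo_I * X)"
  define c where "c = pdo_coeff (X - pdo_D * T) 0"
  have T: "is_diff_op T" unfolding T_def by (rule is_diff_op_plus_part)
  \<comment> \<open>The right side has order at most 0 and the left side is a differential operator,
    so the remainder is a function.\<close>
  have "X - pdo_D * T = pdo_D * (pdo_I * X - T)"
    by (simp add: right_diff_distrib flip: mult.assoc)
  then have "order_le (X - pdo_D * T) 0"
    unfolding T_def by (auto intro!: order_le_mult_le[OF order_le_monom order_le_minus_part])
  moreover have "is_diff_op (X - pdo_D * T)"
    by (intro is_diff_op_intros assms T is_diff_op_monom) simp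
  ultimately have "X - pdo_D * T = pdo_fun c"
    unfolding c_def by (rule is_diff_op_order_0[rotated])
  then have X: "X = pdo_D * T + pdo_fun c" by (simp add: algebra_simps)
  have "pdo_coeff (pdo_adjoint X) 0 = c"
    using is_diff_op_adjoint[OF T]
    by (subst X) (simp add: pdo_adjoint_add pdo_adjoint_mult coeff_mult_D coeff_monom is_diff_op_def)
  moreover have "pdo_I * X = T + pdo_I * pdo_fun c"
    by (subst X) (simp add: distrib_left flip: mult.assoc)
  ultimately show ?thesis by (simp add: T_def)
qed

section \<open>The constrained CKP flows for \<open>q = r\<close>\<close>

definition cckp_rhs :: "'a::diff_algebra \<Rightarrow> nat \<Rightarrow> 'a" where
  "cckp_rhs q m = pdo_apply (cckp_B q q m) q"

definition cckp_residue :: "'a::diff_algebra \<Rightarrow> nat \<Rightarrow> 'a" where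
  "cckp_residue q m = pdo_coeff (cckp_lax q q ^ m) (-1)"

text \<open>The quotient in the left division of q P by \<partial>, where P is
  \<open>cckp_B q q m\<close>.\<close>

definition cckp_quotient :: "'a::diff_algebra \<Rightarrow> nat \<Rightarrow> 'a pdo" where
  "cckp_quotient q m = pdo_plus_part (pdo_I * (pdo_fun q * cckp_B q q m))"

text \<open>The differential part of the Lax operator times \<open>cckp_B q q m\<close>.\<close>

definition cckp_S :: "'a::diff_algebra \<Rightarrow> nat \<Rightarrow> 'a pdo" where
  "cckp_S q m = pdo_D * cckp_B q q m + pdo_fun q * cckp_quotient q m + pdo_fun q * cckp_quotient q m"

text \<open>The quotient of a second left division by \<partial>, which arises when the Lax operator
  is applied once more.\<close>

definition cckp_T :: "'a::diff_algebra \<Rightarrow> nat \<Rightarrow> 'a pdo" where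
  "cckp_T q m = pdo_plus_part (pdo_I * (pdo_fun q * cckp_S q m))"

lemma coeff_sandwich: "pdo_coeff (pdo_fun f * pdo_I * pdo_fun g) (-1) = f * g"
  by (simp add: mult.assoc coeff_fun_mult coeff_monom_mult_monom)

lemma order_le_sandwich: "order_le (pdo_fun f * pdo_I * pdo_fun g) (-1)"
  using order_le_mult[OF order_le_mult[OF order_le_monom order_le_monom] order_le_monom, of f 0 1 "-1" g 0] by simp

lemma cckp_lax_diag: "cckp_lax q q = pdo_D + pdo_fun q * pdo_I * pdo_fun q + pdo_fun q * pdo_I * pdo_fun q"
  by (simp add: cckp_lax_def)

lemma order_le_D_mult:
  assumes "order_le P (-1)"
  shows "order_le (pdo_D * P - pdo_fun (pdo_coeff P (-1))) (-1)"
  unfolding order_le_def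
proof (intro allI impI)
  fix i :: int assume "i > -1"
  then show "pdo_coeff (pdo_D * P - pdo_fun (pdo_coeff P (-1))) i = 0"
    using assms by (cases "i = 0") (simp_all add: order_le_def coeff_D_mult coeff_monom)
qed

text \<open>Two derivatives lift only the coefficients at -1 and -2 to nonnegative order; the factor
  2 is the binomial coefficient of the mixed term.\<close>

lemma order_le_D_mult_D_mult:
  assumes "order_le P (-1)"
  shows "order_le (pdo_D * (pdo_D * P)
    - (pdo_monom (pdo_coeff P (-1)) 1 + pdo_fun (2 * dx (pdo_coeff P (-1)) + pdo_coeff P (-2)))) (-1)"
  unfolding order_le_def
proof (intro allI impI)
  fix i :: int assume "i > -1"
  then consider "i = 0" | "i = 1" | "i > 1" by linarith
  then show "pdo_coeff (pdo_D * (pdo_D * P)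
    - (pdo_monom (pdo_coeff P (-1)) 1 + pdo_fun (2 * dx (pdo_coeff P (-1)) + pdo_coeff P (-2)))) i = 0"
    using assms by cases (simp_all add: order_le_def coeff_D_mult coeff_monom dx_add)
qed

lemma dx_double: "dx (2 * f) = 2 * dx (f :: 'a::diff_algebra)"
  by (simp only: mult_2 dx_add)

text \<open>Regrouping for \<open>cckp_B_step\<close>: each bracket on the right will be an operator
  of negative order. Variables stand for the operators, so that products are not expanded.\<close>

lemma add_diff_rearrange:
  "(ds + t + t + u + u) - (dg + x + x) - (dg + x + x) + (dd + d + d + l + l) - (ds + t + t - (g + g) + a + b)
    = (u + u) - (x + x + x + x) + (d + d) + (l + l) - ((dg - g) + (dg - g)) + (dd - (a + b))"
    for ds t u dg x dd d l g a b :: "'a::ab_group_add"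
  by (simp only: algebra_simps)

locale cckp_diag =
  fixes q :: "'a::diff_algebra" and m :: nat
  assumes odd_m: "odd m"
begin

abbreviation (input) "X \<equiv> pdo_fun q * pdo_I * pdo_fun q"
abbreviation (input) "L \<equiv> cckp_lax q q"
abbreviation (input) "A \<equiv> L ^ m"
abbreviation (input) "P \<equiv> cckp_B q q m"
abbreviation (input) "N \<equiv> A - P"
abbreviation (input) "f \<equiv> cckp_rhs q m"
abbreviation (input) "Q \<equiv> cckp_quotient q m"
abbreviation (input) "S \<equiv> cckp_S q m"
abbreviation (input) "T \<equiv> cckp_T q m"
abbreviation (input) "G \<equiv> pdo_fun q * pdo_I * pdo_fun f"

lemma adjoint_lax: "pdo_adjoint L = - L"
  by (simp add: cckp_lax_diag pdo_adjoint_add pdo_adjoint_mult mult.assoc)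

lemma adjoint_lax_power: "pdo_adjoint A = - A"
  using odd_m by (simp add: pdo_adjoint_power adjoint_lax power_minus_odd)

lemma is_diff_op_B: "is_diff_op P"
  by (simp add: cckp_B_def is_diff_op_plus_part)

lemma adjoint_B: "pdo_adjoint P = - P"
proof -
  have "pdo_plus_part (- A) = - pdo_plus_part A"
    by (rule pdo_eqI) (simp add: coeff_plus_part)
  then show ?thesis
    by (simp add: cckp_B_def adjoint_lax_power flip: plus_part_adjoint)
qed

lemma order_le_N: "order_le N (-1)"
  unfolding cckp_B_def by (rule order_le_minus_part)

lemma is_diff_op_quotient: "is_diff_op Q"
  by (simp add: cckp_quotient_def is_diff_op_plus_part)

text \<open>The remainder of the division is read off from the adjoint of q P, which is - P q
  because P is skew-adjoint.\<close>

lemma I_fun_B: "pdo_I * (pdo_fun q * P) = Q - pdo_I * pdo_fun f"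
proof -
  have "pdo_coeff (pdo_adjoint (pdo_fun q * P)) 0 = - f"
    by (simp add: pdo_adjoint_mult adjoint_B cckp_rhs_def pdo_apply_eq_coeff)
  then show ?thesis
    using pdo_left_division[of "pdo_fun q * P"] is_diff_op_mult[OF is_diff_op_monom[of 0 q] is_diff_op_B]
    by (simp add: cckp_quotient_def pdo_monom_minus)
qed

text \<open>The adjoint of \<open>I_fun_B\<close>; the signs from \<open>P\<close> and
  \<open>pdo_I\<close> cancel.\<close>

lemma B_fun_I: "P * (pdo_fun q * pdo_I) = pdo_adjoint Q + pdo_fun f * pdo_I"
proof -
  have "pdo_adjoint (pdo_I * (pdo_fun q * P)) = pdo_adjoint (Q - pdo_I * pdo_fun f)"
    by (simp only: I_fun_B)
  then show ?thesis
    by (simp add: pdo_adjoint_mult pdo_adjoint_diff adjoint_B mult.assoc)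
qed

text \<open>
  As \<open>P + N\<close> is a power of \<open>L\<close>, the commutator \<open>[P, L] = -[N, L]\<close> has negative order, while the
  divisions above split it into a differential operator and a part of negative order.
\<close>

lemma commutator_B_lax: "P * L - L * P = pdo_fun f * pdo_I * pdo_fun q + pdo_fun f * pdo_I * pdo_fun q + G + G"
  and commutator_B_D: "P * pdo_D + pdo_adjoint Q * pdo_fun q + pdo_adjoint Q * pdo_fun q = S"
  and residue_commutator_B_lax: "pdo_coeff (P * L - L * P) (-1) = dx (cckp_residue q m)"
proof -
  define Y where "Y = P * pdo_D + pdo_adjoint Q * pdo_fun q + pdo_adjoint Q * pdo_fun q - S"
  define Z where "Z = pdo_fun f * pdo_I * pdo_fun q + pdo_fun f * pdo_I * pdo_fun q + G + G"
  have PX: "P * X = pdo_adjoint Q * pdo_fun q + pdo_fun f * pdo_I * pdo_fun q"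
    using B_fun_I by (metis distrib_right mult.assoc)
  have XP: "X * P = pdo_fun q * Q - G"
    by (simp add: mult.assoc I_fun_B right_diff_distrib)
  \<comment> \<open>The two divisions separate the commutator into a differential operator
    \<open>Y\<close> and the nonlocal terms \<open>Z\<close>.\<close>
  have YZ: "P * L - L * P = Y + Z"
  proof -
    have "P * L = P * pdo_D + P * X + P * X" and "L * P = pdo_D * P + X * P + X * P"
      by (simp_all only: cckp_lax_diag distrib_left distrib_right)
    then show ?thesis
      unfolding Y_def Z_def cckp_S_def by (simp only: PX XP) (simp only: algebra_simps)
  qed
  have com: "P * L - L * P = (pdo_D * N - N * pdo_D) + (X * N - N * X) + (X * N - N * X)"
  proof -
    have "P * L - L * P = L * N - N * L"
      by (simp add: right_diff_distrib left_diff_distrib power_commutes)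
    then show ?thesis by (simp add: cckp_lax_diag distrib_left distrib_right)
  qed
  \<comment> \<open>Order -2 keeps these terms out of the residue, which is therefore the derivative
    of the residue of \<open>N\<close>.\<close>
  have XN: "order_le (X * N - N * X) (-2)"
    by (intro order_le_diff order_le_mult_le[OF order_le_sandwich order_le_N]
        order_le_mult_le[OF order_le_N order_le_sandwich]) simp_all
  have DN: "pdo_coeff (pdo_D * N - N * pdo_D) k = dx (pdo_coeff N k)" for k
    by (simp only: coeff_diff[of "pdo_D * N"] coeff_D_mult coeff_mult_D) simp
  have "order_le (pdo_D * N - N * pdo_D) (-1)"
    using order_le_N unfolding order_le_def DN by simp
  with XN have "order_le (Y + Z) (-1)"
    unfolding YZ[symmetric] com by (auto intro!: order_le_add intro: order_le_mono)
  moreover have "order_le Z (-1)"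
    unfolding Z_def by (intro order_le_add order_le_sandwich)
  ultimately have "order_le Y (-1)"
    using order_le_diff[of "Y + Z" "-1" Z] by simp
  moreover have "is_diff_op Y"
    unfolding Y_def cckp_S_def
    by (intro is_diff_op_intros is_diff_op_B is_diff_op_adjoint is_diff_op_quotient is_diff_op_monom) simp_all
  ultimately have "Y = 0" using is_diff_op_negative_order by blast
  then show "P * pdo_D + pdo_adjoint Q * pdo_fun q + pdo_adjoint Q * pdo_fun q = S"
    and "P * L - L * P = pdo_fun f * pdo_I * pdo_fun q + pdo_fun f * pdo_I * pdo_fun q + G + G"
    using YZ by (simp_all add: Y_def Z_def)
  have "pdo_coeff (P * L - L * P) (-1) = dx (pdo_coeff N (-1))"
    using XN unfolding com by (simp add: DN order_le_def del: coeff_diff)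
  then show "pdo_coeff (P * L - L * P) (-1) = dx (cckp_residue q m)"
    by (simp add: cckp_residue_def cckp_B_def coeff_plus_part)
qed

text \<open>Each of the four nonlocal terms of the commutator has residue q f.\<close>

lemma dx_residue: "dx (cckp_residue q m) = 4 * (q * f)"
  using residue_commutator_B_lax unfolding commutator_B_lax
  by (simp add: coeff_sandwich mult.commute)

text \<open>Applying q P = \<partial> Q - f to q gives q f on the left and an extra - f q on the
  right.\<close>

lemma dx_apply_quotient: "dx (pdo_apply Q q) = 2 * (q * f)"
proof -
  have "pdo_fun q * P = pdo_D * (pdo_I * (pdo_fun q * P))"
    by (simp flip: mult.assoc)
  also have "\<dots> = pdo_D * Q - pdo_fun f"
    unfolding I_fun_B by (simp add: right_diff_distrib flip: mult.assoc)
  finally have "pdo_fun q * P * pdo_fun q = pdo_D * Q * pdo_fun q - pdo_fun f * pdo_fun q"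
    by (simp add: left_diff_distrib)
  then have "pdo_coeff (pdo_fun q * P * pdo_fun q) 0 = dx (pdo_apply Q q) - f * q"
    by (simp add: coeff_D_mult_fun is_diff_op_quotient pdo_fun_mult_monom coeff_monom)
  moreover have "pdo_coeff (pdo_fun q * P * pdo_fun q) 0 = q * f"
    by (simp add: mult.assoc coeff_fun_mult cckp_rhs_def pdo_apply_eq_coeff)
  ultimately show ?thesis by (simp add: algebra_simps)
qed

lemma is_diff_op_S: "is_diff_op S"
  unfolding cckp_S_def
  by (intro is_diff_op_intros is_diff_op_B is_diff_op_quotient is_diff_op_monom) simp_all

lemma is_diff_op_T: "is_diff_op T"
  by (simp add: cckp_T_def is_diff_op_plus_part)

text \<open>The adjoint turns the definition of \<open>S\<close> into the other expression for it,
  found in \<open>commutator_B_D\<close>.\<close>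

lemma adjoint_S: "pdo_adjoint S = S"
proof -
  have "pdo_adjoint S = P * pdo_D + pdo_adjoint Q * pdo_fun q + pdo_adjoint Q * pdo_fun q"
    unfolding cckp_S_def by (simp add: pdo_adjoint_add pdo_adjoint_mult adjoint_B)
  then show ?thesis by (simp add: commutator_B_D)
qed

lemma apply_S: "pdo_apply S q = dx f + 2 * q * pdo_apply Q q"
proof -
  have "pdo_apply S q = pdo_coeff (pdo_D * P * pdo_fun q) 0 + 2 * pdo_coeff (pdo_fun q * (Q * pdo_fun q)) 0"
    unfolding pdo_apply_eq_coeff[of S] unfolding cckp_S_def by (simp add: distrib_right mult.assoc)
  then show ?thesis
    by (simp add: coeff_D_mult_fun is_diff_op_B coeff_fun_mult pdo_apply_eq_coeff cckp_rhs_def)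
qed

text \<open>As in \<open>I_fun_B\<close>, but self-adjointness of \<open>S\<close> makes the
  remainder positive.\<close>

lemma I_fun_S: "pdo_I * (pdo_fun q * S) = T + pdo_I * pdo_fun (pdo_apply S q)"
proof -
  have "pdo_coeff (pdo_adjoint (pdo_fun q * S)) 0 = pdo_apply S q"
    by (simp add: pdo_adjoint_mult adjoint_S pdo_apply_eq_coeff)
  then show ?thesis
    using pdo_left_division[of "pdo_fun q * S"] is_diff_op_mult[OF is_diff_op_monom[of 0 q] is_diff_op_S]
    by (simp add: cckp_T_def)
qed

text \<open>Applying q S = \<partial> T + S(q) to q produces q S(q) on both sides, and these
  cancel.\<close>

lemma dx_apply_T: "dx (pdo_apply T q) = 0"
proof -
  let ?c = "pdo_apply S q"
  have "pdo_fun q * S = pdo_D * (pdo_I * (pdo_fun q * S))"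
    by (simp flip: mult.assoc)
  also have "\<dots> = pdo_D * T + pdo_fun ?c"
    unfolding I_fun_S by (simp add: distrib_left flip: mult.assoc)
  finally have "pdo_fun q * S * pdo_fun q = pdo_D * T * pdo_fun q + pdo_fun ?c * pdo_fun q"
    by (simp add: distrib_right)
  then have "pdo_coeff (pdo_fun q * S * pdo_fun q) 0 = dx (pdo_apply T q) + ?c * q"
    by (simp add: coeff_D_mult_fun is_diff_op_T pdo_fun_mult_monom coeff_monom)
  moreover have "pdo_coeff (pdo_fun q * S * pdo_fun q) 0 = q * ?c"
    by (simp add: mult.assoc coeff_fun_mult pdo_apply_eq_coeff)
  ultimately show ?thesis by (simp add: algebra_simps)
qed

text \<open>\<open>N\<close> is skew-adjoint; with a and b its coefficients at -1 and -2, comparison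
  at -2 gives - b = b + a_x.\<close>

lemma coeff_N_minus_2: "2 * pdo_coeff N (-2) = - dx (cckp_residue q m)"
proof -
  have "pdo_adjoint N = - N"
    by (simp add: pdo_adjoint_diff adjoint_lax_power adjoint_B)
  moreover have "{-2..-1} = {-2, -1 :: int}" by auto
  then have "pdo_coeff (pdo_adjoint N) (-2) = pdo_coeff N (-2) + dx (pdo_coeff N (-1))"
    by (simp add: coeff_adjoint[OF order_le_N] del: coeff_diff)
  ultimately have "- pdo_coeff N (-2) = pdo_coeff N (-2) + dx (pdo_coeff N (-1))"
    by (simp only: coeff_minus)
  then have "dx (pdo_coeff N (-1)) = - pdo_coeff N (-2) - pdo_coeff N (-2)"
    by (metis add_diff_cancel_left')
  moreover have "pdo_coeff N (-1) = cckp_residue q m"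
    by (simp add: cckp_residue_def cckp_B_def coeff_plus_part)
  ultimately have "dx (cckp_residue q m) = - pdo_coeff N (-2) - pdo_coeff N (-2)"
    by (simp only:)
  then show ?thesis by (simp only: mult_2 minus_diff_eq diff_minus_eq_add)
qed

text \<open>The power splits as L (L P) + L (L N), and L P = S - 2 G. Besides the differential part
  of L S, nonnegative orders come from \<partial> G, whose leading coefficient is q f, and from
  \<partial> \<partial> N.\<close>

lemma cckp_B_step:
  "cckp_B q q (m + 2) = pdo_D * S + pdo_fun q * T + pdo_fun q * T - pdo_fun (2 * (q * f))
    + pdo_monom (cckp_residue q m) 1 + pdo_fun (2 * dx (cckp_residue q m) + pdo_coeff N (-2))"
  (is "_ = ?R")
proof -
  let ?a = "cckp_residue q m"
  let ?U = "pdo_fun q * pdo_I * pdo_fun (pdo_apply S q)"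
  have LP: "L * P = S - G - G"
    unfolding cckp_lax_diag cckp_S_def
    by (simp add: distrib_right mult.assoc I_fun_B right_diff_distrib)
  have LS: "L * S = pdo_D * S + pdo_fun q * T + pdo_fun q * T + ?U + ?U"
    unfolding cckp_lax_diag
    by (simp add: distrib_right mult.assoc I_fun_S distrib_left)
  have LG: "L * G = pdo_D * G + X * G + X * G"
    unfolding cckp_lax_diag by (simp add: distrib_right)
  have LLN: "L * (L * N) = pdo_D * (pdo_D * N) + pdo_D * (X * N) + pdo_D * (X * N)
      + X * (L * N) + X * (L * N)"
  proof -
    have expand: "L * n = pdo_D * n + X * n + X * n" for n
      unfolding cckp_lax_diag by (simp add: distrib_right)
    have "L * (L * N) = pdo_D * (L * N) + X * (L * N) + X * (L * N)" by (rule expand)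
    also have "pdo_D * (L * N) = pdo_D * (pdo_D * N) + pdo_D * (X * N) + pdo_D * (X * N)"
      unfolding expand[of N] by (simp only: distrib_left)
    finally show ?thesis .
  qed
  have "L ^ (m + 2) = L * (L * P) + L * (L * N)"
    by (simp add: right_diff_distrib)
  then have L2: "L ^ (m + 2) = L * S - L * G - L * G + L * (L * N)"
    by (simp only: LP right_diff_distrib)
  have fun2: "pdo_fun (2 * (q * f)) = pdo_fun (q * f) + pdo_fun (q * f)"
    by (simp only: mult_2 pdo_monom_add)
  have "L ^ (m + 2) - ?R =
      (?U + ?U) - (X * G + X * G + X * G + X * G) + (pdo_D * (X * N) + pdo_D * (X * N))
      + (X * (L * N) + X * (L * N)) - ((pdo_D * G - pdo_fun (q * f)) + (pdo_D * G - pdo_fun (q * f)))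
      + (pdo_D * (pdo_D * N) - (pdo_monom ?a 1 + pdo_fun (2 * dx ?a + pdo_coeff N (-2))))"
    unfolding L2 unfolding LLN unfolding LS unfolding LG unfolding fun2 by (rule add_diff_rearrange)
  moreover have "order_le \<dots> (-1)"
  proof -
    have U: "order_le ?U (-1)" by (rule order_le_sandwich)
    have XG: "order_le (X * G) (-1)" by (rule order_le_mult_le[OF order_le_sandwich order_le_sandwich]) simp
    have "order_le (X * N) (-2)" by (rule order_le_mult_le[OF order_le_sandwich order_le_N]) simp
    then have DXN: "order_le (pdo_D * (X * N)) (-1)" by (rule order_le_mult_le[OF order_le_monom]) simp
    have "order_le L 1"
      unfolding cckp_lax_diag
      by (intro order_le_add order_le_monom order_le_mono[OF order_le_sandwich]) simp_all
    then have "order_le (L * N) 0" by (rule order_le_mult_le[OF _ order_le_N]) simp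
    then have XLN: "order_le (X * (L * N)) (-1)" by (rule order_le_mult_le[OF order_le_sandwich]) simp
    have DG: "order_le (pdo_D * G - pdo_fun (q * f)) (-1)"
      using order_le_D_mult[OF order_le_sandwich[of q f]] by (simp only: coeff_sandwich)
    have "pdo_coeff N (-1) = ?a"
      by (simp add: cckp_residue_def cckp_B_def coeff_plus_part)
    then have DDN: "order_le (pdo_D * (pdo_D * N) - (pdo_monom ?a 1 + pdo_fun (2 * dx ?a + pdo_coeff N (-2)))) (-1)"
      using order_le_D_mult_D_mult[OF order_le_N] by (simp only:)
    show ?thesis
      by (rule U XG DXN XLN DG DDN order_le_add order_le_diff)+
  qed
  ultimately have "order_le (L ^ (m + 2) - ?R) (-1)" by (simp only:)
  moreover have "is_diff_op ?R"
    by (intro is_diff_op_intros is_diff_op_S is_diff_op_T is_diff_op_monom) simp_all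
  ultimately show ?thesis
    unfolding cckp_B_def[of q q "m + 2"] by (rule plus_part_eqI[rotated])
qed

lemma cckp_rhs_step:
  "cckp_rhs q (m + 2) = dx (dx f) + 8 * q\<^sup>2 * f + dx q * (2 * pdo_apply Q q + cckp_residue q m)
     + 2 * q * pdo_apply T q"
proof -
  let ?a = "cckp_residue q m"
  \<comment> \<open>Twice the bracket is 4 a_x - a_x = 3 a_x = 12 q f, with a the residue.\<close>
  have "2 *\<^sub>R (2 * dx ?a + pdo_coeff N (-2)) = 2 *\<^sub>R (6 * (q * f))"
    using coeff_N_minus_2 by (simp add: dx_residue scaleR_2 algebra_simps del: coeff_diff)
  then have a2: "2 * dx ?a + pdo_coeff N (-2) = 6 * (q * f)"
    by (rule scaleR_left_imp_eq[rotated]) simp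
  have a1: "pdo_coeff (pdo_monom ?a 1 * pdo_fun q) 0 = ?a * dx q"
    by (simp add: coeff_monom_mult_monom)
  have "cckp_rhs q (m + 2) = dx (pdo_apply S q) + 2 * (q * pdo_apply T q) - 2 * (q * f) * q + ?a * dx q + 6 * (q * f) * q"
    unfolding cckp_rhs_def[of q "m + 2"] pdo_apply_eq_coeff[of "cckp_B q q (m + 2)"]
    unfolding cckp_B_step a2
    unfolding distrib_right[of _ _ "pdo_fun q"] left_diff_distrib[of _ _ "pdo_fun q"]
      coeff_add coeff_diff a1 coeff_D_mult_fun[OF is_diff_op_S]
    by (simp add: mult.assoc coeff_fun_mult pdo_apply_eq_coeff coeff_monom)
  \<comment> \<open>This contributes 4 q^2 f; together with - 2 q^2 f and 6 q^2 f from the line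
    above it makes the coefficient 8 of the recursion operator.\<close>
  also have "dx (pdo_apply S q) = dx (dx f) + 2 * (dx q * pdo_apply Q q) + 4 * (q * (q * f))"
    unfolding apply_S mult.assoc dx_add dx_double unfolding dx_mult dx_apply_quotient by (simp add: algebra_simps)
  finally show ?thesis by (simp add: power2_eq_square algebra_simps)
qed

end

section \<open>The first flow and the Lax equation\<close>

lemma cckp_rhs_1: "cckp_rhs q 1 = dx q"
proof -
  have "cckp_B q q 1 = pdo_D"
    unfolding cckp_B_def
  proof (rule plus_part_eqI)
    show "is_diff_op (pdo_D :: 'a pdo)" by (rule is_diff_op_monom) simp
    show "order_le (cckp_lax q q ^ 1 - pdo_D) (-1)"
      using order_le_add[OF order_le_sandwich[of q q] order_le_sandwich[of q q]]
      by (simp add: cckp_lax_diag)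
  qed
  then show ?thesis
    by (simp add: cckp_rhs_def pdo_apply_eq_coeff coeff_monom_mult_monom)
qed

lemma time_derivative_dx_funpow: "time_derivative D \<Longrightarrow> D ((dx ^^ n) f) = (dx ^^ n) (D f)"
  by (induction n) (simp_all add: time_derivative_def)

lemma time_derivative_zero: "time_derivative D \<Longrightarrow> D 0 = 0"
proof -
  assume "time_derivative D"
  then have "D (0 + 0) = D 0 + D 0" unfolding time_derivative_def by blast
  then show "D 0 = 0" by simp
qed

lemma time_derivative_one: "time_derivative D \<Longrightarrow> D 1 = 0"
proof -
  assume "time_derivative D"
  then have "D (1 * 1) = D 1 * 1 + 1 * D 1" unfolding time_derivative_def by blast
  then show "D 1 = 0" by simp
qed

lemma coeff_time_derivative:
  assumes "time_derivative D"
  shows "pdo_coeff (pdo_coeff_deriv D P) i = D (pdo_coeff P i)"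
  using time_derivative_zero[OF assms] by transfer simp

lemma time_derivative_sandwich:
  assumes "time_derivative D"
  shows "pdo_coeff_deriv D (pdo_fun f * pdo_I * pdo_fun g)
    = pdo_fun (D f) * pdo_I * pdo_fun g + pdo_fun f * pdo_I * pdo_fun (D g)"
proof -
  have D: "D (f + g) = D f + D g" "D (c *\<^sub>R f) = c *\<^sub>R D f" "D (f * g) = D f * g + f * D g" for c f g
    using assms by (simp_all add: time_derivative_def)
  have "pdo_fun a * pdo_I * pdo_fun b = pdo_monom a (-1) * pdo_fun b" for a b :: 'a
    by (simp add: pdo_monom_mult_D)
  moreover have "pdo_coeff (pdo_coeff_deriv D (pdo_monom f (-1) * pdo_fun g)) k =
      pdo_coeff (pdo_monom (D f) (-1) * pdo_fun g + pdo_monom f (-1) * pdo_fun (D g)) k" for k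
    using time_derivative_zero[OF assms]
    by (simp add: coeff_time_derivative[OF assms] coeff_monom_mult_monom D(2,3)
        time_derivative_dx_funpow[OF assms] scaleR_add_right)
  ultimately show ?thesis by (simp only: pdo_eqI)
qed

text \<open>The evolution of q implies the Lax equation, because differentiating both nonlocal terms
  by the product rule yields exactly the commutator; the adjoint equation agrees because the
  operator is skew-adjoint.\<close>

lemma cckp_flow_diag_iff:
  assumes D: "time_derivative (Dt m)" and m: "odd m"
  shows "cckp_flow Dt q q m \<longleftrightarrow> Dt m q = cckp_rhs q m"
proof
  show "cckp_flow Dt q q m \<Longrightarrow> Dt m q = cckp_rhs q m"
    by (simp add: cckp_flow_def cckp_rhs_def)
  assume flow: "Dt m q = cckp_rhs q m"
  have add: "pdo_coeff_deriv (Dt m) (P + Q) = pdo_coeff_deriv (Dt m) P + pdo_coeff_deriv (Dt m) Q" for P Q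
  proof (rule pdo_eqI)
    have "Dt m (f + g) = Dt m f + Dt m g" for f g using D by (simp add: time_derivative_def)
    then show "pdo_coeff (pdo_coeff_deriv (Dt m) (P + Q)) i = pdo_coeff (pdo_coeff_deriv (Dt m) P + pdo_coeff_deriv (Dt m) Q) i" for i
      by (simp add: coeff_time_derivative[OF D])
  qed
  have "pdo_coeff_deriv (Dt m) pdo_D = 0"
    by (intro pdo_eqI)
      (simp add: coeff_time_derivative[OF D] coeff_monom time_derivative_zero[OF D] time_derivative_one[OF D])
  then have "pdo_coeff_deriv (Dt m) (cckp_lax q q) = cckp_B q q m * cckp_lax q q - cckp_lax q q * cckp_B q q m"
    unfolding cckp_diag.commutator_B_lax[OF cckp_diag.intro, OF m] unfolding cckp_lax_diag add time_derivative_sandwich[OF D]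
    by (simp add: flow)
  moreover have "pdo_apply (- P) f = - pdo_apply P f" for P and f :: 'a
    by (simp add: pdo_apply_eq_coeff)
  ultimately show "cckp_flow Dt q q m"
    using flow by (simp add: cckp_flow_def cckp_rhs_def cckp_diag.adjoint_B[OF cckp_diag.intro, OF m])
qed

section \<open>Differential polynomials\<close>

text \<open>Sums with overlapping supports are allowed, which suits additive maps. The rule serves
  both for polynomials and for their exponent vectors.\<close>

lemma poly_mapping_add_induct [case_names single add]:
  fixes p :: "'k \<Rightarrow>\<^sub>0 'v::comm_monoid_add"
  assumes "\<And>a c. R (Poly_Mapping.single a c)" "\<And>p q. R p \<Longrightarrow> R q \<Longrightarrow> R (p + q)"
  shows "R p"
proof -
  have "R (\<Sum>a\<in>A. Poly_Mapping.single a (Poly_Mapping.lookup p a))" if "finite A" for A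
    using that
  proof induction
    case empty
    \<comment> \<open>Zero is the single term with coefficient 0.\<close>
    show ?case using assms(1)[of undefined 0] by simp
  qed (simp add: assms)
  moreover have "p = (\<Sum>a\<in>Poly_Mapping.keys p. Poly_Mapping.single a (Poly_Mapping.lookup p a))"
    by (rule poly_mapping_eqI) (auto simp: lookup_sum lookup_single when_def in_keys_iff)
  ultimately show ?thesis by (metis finite_keys)
qed

section \<open>The total derivative as a derivation\<close>

lemma total_deriv_superset:
  assumes "finite A" "Poly_Mapping.keys P \<subseteq> A"
  shows "total_deriv P = (\<Sum>a\<in>A. \<Sum>i\<in>Poly_Mapping.keys a. Poly_Mapping.single
    (a - Poly_Mapping.single i 1 + Poly_Mapping.single (Suc i) 1)
    (Poly_Mapping.lookup P a * real (Poly_Mapping.lookup a i)))"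
  unfolding total_deriv_def using assms by (intro sum.mono_neutral_left) (auto simp: in_keys_iff)

lemma total_deriv_add: "total_deriv (P + Q) = total_deriv P + total_deriv Q"
proof -
  let ?A = "Poly_Mapping.keys P \<union> Poly_Mapping.keys Q"
  have "Poly_Mapping.keys (P + Q) \<subseteq> ?A" by (rule Poly_Mapping.keys_add)
  then show ?thesis
    by (simp add: total_deriv_superset[of ?A] lookup_add distrib_right single_add sum.distrib)
qed

lemma total_deriv_single: "total_deriv (Poly_Mapping.single a c) = (\<Sum>i\<in>Poly_Mapping.keys a.
    Poly_Mapping.single (a - Poly_Mapping.single i 1 + Poly_Mapping.single (Suc i) 1)
      (c * real (Poly_Mapping.lookup a i)))"
  by (simp add: total_deriv_superset[of "{a}"])

lemma total_deriv_single_superset: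
  assumes "finite A" "Poly_Mapping.keys a \<subseteq> A"
  shows "total_deriv (Poly_Mapping.single a c) = (\<Sum>i\<in>A.
    Poly_Mapping.single (a - Poly_Mapping.single i 1 + Poly_Mapping.single (Suc i) 1)
      (c * real (Poly_Mapping.lookup a i)))"
  unfolding total_deriv_single using assms by (intro sum.mono_neutral_left) (auto simp: in_keys_iff)

lemma total_deriv_single_mult:
  "total_deriv (Poly_Mapping.single a c * Poly_Mapping.single b d)
    = total_deriv (Poly_Mapping.single a c) * Poly_Mapping.single b d
      + Poly_Mapping.single a c * total_deriv (Poly_Mapping.single b d)"
proof -
  let ?A = "Poly_Mapping.keys a \<union> Poly_Mapping.keys b"
  let ?s = "\<lambda>i. Poly_Mapping.single i (1 :: nat)"
  \<comment> \<open>Subtraction of exponents is truncated: where the exponent at i is 0 the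
    coefficient vanishes, and elsewhere the subtraction commutes with adding b'.\<close>
  have shift: "Poly_Mapping.single (a' - ?s i + ?s (Suc i)) (e * real (Poly_Mapping.lookup a' i)) * Poly_Mapping.single b' h
    = Poly_Mapping.single (a' + b' - ?s i + ?s (Suc i)) (e * h * real (Poly_Mapping.lookup a' i))"
    for a' b' :: "nat \<Rightarrow>\<^sub>0 nat" and e h i
  proof (cases "Poly_Mapping.lookup a' i = 0")
    case False
    have "a' - ?s i + ?s (Suc i) + b' = a' + b' - ?s i + ?s (Suc i)"
      by (rule poly_mapping_eqI) (use False in \<open>auto simp: lookup_add lookup_minus lookup_single when_def\<close>)
    then show ?thesis by (simp add: mult_single ac_simps)
  qed simp
  have sub: "Poly_Mapping.keys (a + b) \<subseteq> ?A" by (rule Poly_Mapping.keys_add)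
  have "total_deriv (Poly_Mapping.single a c * Poly_Mapping.single b d)
    = (\<Sum>i\<in>?A. Poly_Mapping.single (a + b - ?s i + ?s (Suc i)) (c * d * real (Poly_Mapping.lookup (a + b) i)))"
    unfolding mult_single using sub by (intro total_deriv_single_superset) simp_all
  also have "\<dots> = (\<Sum>i\<in>?A. Poly_Mapping.single (a + b - ?s i + ?s (Suc i)) (c * d * real (Poly_Mapping.lookup a i)))
     + (\<Sum>i\<in>?A. Poly_Mapping.single (b + a - ?s i + ?s (Suc i)) (d * c * real (Poly_Mapping.lookup b i)))"
    by (simp add: lookup_add distrib_left single_add sum.distrib ac_simps)
  also have "\<dots> = total_deriv (Poly_Mapping.single a c) * Poly_Mapping.single b d
      + total_deriv (Poly_Mapping.single b d) * Poly_Mapping.single a c"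
    unfolding shift[symmetric] sum_distrib_right[symmetric]
    by (simp add: total_deriv_single_superset[of ?A])
  finally show ?thesis by (simp add: mult.commute)
qed

lemma total_deriv_mult: "total_deriv (P * Q) = total_deriv P * Q + P * total_deriv Q"
proof (induction P rule: poly_mapping_add_induct)
  case (single a c)
  show ?case
  proof (induction Q rule: poly_mapping_add_induct)
    case (single b d)
    show ?case by (rule total_deriv_single_mult)
  qed (simp add: distrib_left total_deriv_add)
qed (simp add: distrib_right total_deriv_add)

lemma total_deriv_const_mult: "total_deriv (const_dp c * P) = const_dp c * total_deriv P"
  by (simp add: total_deriv_mult const_dp_def total_deriv_single)

text \<open>
  If \<open>u\<^sub>N\<close> is the highest derivative in \<open>W\<close> and occurs in the monomial \<open>a\<close>, then the
  monomial \<open>a u\<^sub>N\<^sub>+\<^sub>1 / u\<^sub>N\<close> of the total derivative of \<open>W\<close> comes from \<open>a\<close> alone.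
\<close>

lemma total_deriv_eq_0_imp:
  assumes "total_deriv W = 0" "Poly_Mapping.lookup W 0 = 0"
  shows "W = 0"
proof (rule ccontr)
  assume "W \<noteq> 0"
  let ?s = "\<lambda>i. Poly_Mapping.single i (1 :: nat)"
  define I where "I = (\<Union>a\<in>Poly_Mapping.keys W. Poly_Mapping.keys a)"
  obtain a0 where "a0 \<in> Poly_Mapping.keys W"
    using \<open>W \<noteq> 0\<close> by (metis poly_mapping_eqI in_keys_iff lookup_zero)
  \<comment> \<open>The constant term vanishes, so some jet variable occurs and a highest derivative
    exists.\<close>
  moreover from this have "a0 \<noteq> 0" using assms(2) by (auto simp: in_keys_iff)
  then have "Poly_Mapping.keys a0 \<noteq> {}" by simp
  ultimately have "I \<noteq> {}" by (auto simp: I_def)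
  moreover have "finite I" by (simp add: I_def)
  ultimately have "Max I \<in> I" and Max: "\<And>i. i \<in> I \<Longrightarrow> i \<le> Max I" by simp_all
  define N where "N = Max I"
  obtain a where a: "a \<in> Poly_Mapping.keys W" "N \<in> Poly_Mapping.keys a"
    using \<open>Max I \<in> I\<close> by (auto simp: I_def N_def)
  have le: "i \<le> N" if "b \<in> Poly_Mapping.keys W" "i \<in> Poly_Mapping.keys b" for b i
    unfolding N_def by (rule Max) (use that in \<open>auto simp: I_def\<close>)
  then have above: "Poly_Mapping.lookup b (Suc N) = 0" if "b \<in> Poly_Mapping.keys W" for b
    using that by (metis Suc_n_not_le_n in_keys_iff)
  define t where "t = a - ?s N + ?s (Suc N)"
  \<comment> \<open>No monomial of \<open>W\<close> contains the jet of index N + 1, so it can only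
    come from i = N; as both b and a contain the jet of index N, the truncated subtraction can be
    undone.\<close>
  have unique: "b - ?s i + ?s (Suc i) = t \<longleftrightarrow> b = a \<and> i = N"
    if b: "b \<in> Poly_Mapping.keys W" and i: "i \<in> Poly_Mapping.keys b" for b i
  proof
    assume eq: "b - ?s i + ?s (Suc i) = t"
    have "Poly_Mapping.lookup (b - ?s i + ?s (Suc i)) (Suc N) = (if i = N then 1 else 0)"
      using above[OF b] by (simp add: lookup_add lookup_minus lookup_single when_def)
    moreover have "Poly_Mapping.lookup t (Suc N) = 1"
      using above[OF a(1)] by (simp add: t_def lookup_add lookup_minus lookup_single when_def)
    ultimately have "(if i = N then 1 else 0) = (1 :: nat)" using eq by (simp only:)
    then have "i = N" by (simp split: if_splits)
    have "Poly_Mapping.lookup b j = Poly_Mapping.lookup a j" for j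
    proof -
      have "Poly_Mapping.lookup (b - ?s N) j = Poly_Mapping.lookup (a - ?s N) j"
        using eq \<open>i = N\<close> by (simp add: t_def)
      then show ?thesis using i a(2) \<open>i = N\<close>
        by (auto simp: lookup_minus lookup_single when_def in_keys_iff split: if_splits)
    qed
    then show "b = a \<and> i = N" using \<open>i = N\<close> by (simp add: poly_mapping_eqI)
  qed (simp add: t_def)
  have "Poly_Mapping.lookup (total_deriv W) t = (\<Sum>b\<in>Poly_Mapping.keys W. \<Sum>i\<in>Poly_Mapping.keys b.
      (Poly_Mapping.lookup W b * real (Poly_Mapping.lookup b i) when b - ?s i + ?s (Suc i) = t))"
    by (simp add: total_deriv_def lookup_sum lookup_single)
  also have "\<dots> = (\<Sum>b\<in>Poly_Mapping.keys W. \<Sum>i\<in>Poly_Mapping.keys b.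
      if b = a then if i = N then Poly_Mapping.lookup W a * real (Poly_Mapping.lookup a N) else 0 else 0)"
    by (intro sum.cong refl) (simp only: when_def unique, auto)
  also have "\<dots> = (\<Sum>b\<in>Poly_Mapping.keys W. if b = a then
      (\<Sum>i\<in>Poly_Mapping.keys a. if i = N then Poly_Mapping.lookup W a * real (Poly_Mapping.lookup a N) else 0) else 0)"
    by (intro sum.cong refl) auto
  also have "\<dots> = Poly_Mapping.lookup W a * real (Poly_Mapping.lookup a N)"
    using a by simp
  finally show False using assms(1) a by (simp add: in_keys_iff)
qed

section \<open>Evaluation of differential polynomials\<close>

definition eval_monomial :: "(nat \<Rightarrow>\<^sub>0 nat) \<Rightarrow> 'a::diff_algebra \<Rightarrow> 'a" where
  "eval_monomial a u = (\<Prod>i\<in>Poly_Mapping.keys a. (dx ^^ i) u ^ Poly_Mapping.lookup a i)"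

lemma eval_monomial_superset:
  assumes "finite A" "Poly_Mapping.keys a \<subseteq> A"
  shows "eval_monomial a u = (\<Prod>i\<in>A. (dx ^^ i) u ^ Poly_Mapping.lookup a i)"
  unfolding eval_monomial_def using assms by (intro prod.mono_neutral_left) (auto simp: in_keys_iff)

lemma eval_monomial_add: "eval_monomial (a + b) u = eval_monomial a u * eval_monomial b u"
proof -
  let ?A = "Poly_Mapping.keys a \<union> Poly_Mapping.keys b"
  have "Poly_Mapping.keys (a + b) \<subseteq> ?A" by (rule Poly_Mapping.keys_add)
  then show ?thesis
    by (simp add: eval_monomial_superset[of ?A] lookup_add power_add prod.distrib)
qed

lemma eval_dp_superset:
  assumes "finite A" "Poly_Mapping.keys P \<subseteq> A"
  shows "eval_dp P u = (\<Sum>a\<in>A. Poly_Mapping.lookup P a *\<^sub>R eval_monomial a u)"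
  unfolding eval_dp_def eval_monomial_def[symmetric]
  using assms by (intro sum.mono_neutral_left) (auto simp: in_keys_iff)

lemma eval_dp_add: "eval_dp (P + Q) u = eval_dp P u + eval_dp Q u"
proof -
  let ?A = "Poly_Mapping.keys P \<union> Poly_Mapping.keys Q"
  have "Poly_Mapping.keys (P + Q) \<subseteq> ?A" by (rule Poly_Mapping.keys_add)
  then show ?thesis
    by (simp add: eval_dp_superset[of ?A] lookup_add scaleR_add_left sum.distrib)
qed

lemma eval_dp_single: "eval_dp (Poly_Mapping.single a c) u = c *\<^sub>R eval_monomial a u"
  by (simp add: eval_dp_superset[of "{a}"])

lemma eval_dp_mult: "eval_dp (P * Q) u = eval_dp P u * eval_dp Q u"
proof (induction P rule: poly_mapping_add_induct)
  case (single a c)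
  show ?case
  proof (induction Q rule: poly_mapping_add_induct)
    case (single b d)
    show ?case by (simp add: mult_single eval_dp_single eval_monomial_add)
  qed (simp add: distrib_left eval_dp_add)
qed (simp add: distrib_right eval_dp_add)

lemma eval_dp_const: "eval_dp (const_dp c) u = c *\<^sub>R 1"
  by (simp add: const_dp_def eval_dp_single eval_monomial_def)

lemma eval_dp_one: "eval_dp 1 u = 1"
  using eval_dp_const[of 1 u] by (simp add: const_dp_def)

lemma eval_dp_jet: "eval_dp (jet i) u = (dx ^^ i) u"
  by (simp add: jet_def eval_dp_single eval_monomial_def)

text \<open>Turns the normalisation of the formal antiderivative into a statement about a
  homomorphism.\<close>

lemma eval_dp_at_0: "eval_dp P 0 = Poly_Mapping.lookup P 0 *\<^sub>R (1 :: 'a::diff_algebra)"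
proof (induction P rule: poly_mapping_add_induct)
  case (single a c)
  show ?case
  proof (cases "a = 0")
    case False
    then obtain i where "i \<in> Poly_Mapping.keys a" by (metis all_not_in_conv keys_eq_empty)
    then have "eval_monomial a (0 :: 'a) = 0"
      unfolding eval_monomial_def by (intro prod_zero) (auto simp: in_keys_iff power_0_left)
    then show ?thesis using False by (simp add: eval_dp_single lookup_single)
  qed (simp add: eval_dp_single eval_monomial_def)
qed (simp add: eval_dp_add lookup_add scaleR_add_left)

lemma total_deriv_jet: "total_deriv (jet i) = jet (Suc i)"
  by (simp add: jet_def total_deriv_single)

text \<open>Both sides obey the product rule in P, so it suffices to compare them on constants and
  jets; the inductions run over sums, exponent vectors and powers.\<close>

lemma eval_dp_total_deriv: "eval_dp (total_deriv P) u = dx (eval_dp P u)"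
proof (induction P rule: poly_mapping_add_induct)
  case (single a c)
  have dx1: "dx (c *\<^sub>R (1 :: 'a)) = 0" for c by (simp add: dx_scaleR)
  have const: "eval_dp (total_deriv (const_dp c)) u = dx (eval_dp (const_dp c) u)" for c
    unfolding eval_dp_const dx1 by (simp add: const_dp_def total_deriv_single eval_dp_def)
  have mult: "eval_dp (total_deriv (P * Q)) u = dx (eval_dp (P * Q) u)"
    if "eval_dp (total_deriv P) u = dx (eval_dp P u)" "eval_dp (total_deriv Q) u = dx (eval_dp Q u)" for P Q
    using that by (simp add: total_deriv_mult eval_dp_add eval_dp_mult dx_mult)
  show ?case
  proof (induction a arbitrary: c rule: poly_mapping_add_induct)
    case (single i n)
    show ?case
    proof (induction n arbitrary: c)
      case 0
      show ?case using const by (simp add: const_dp_def)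
    next
      case (Suc n)
      have "Poly_Mapping.single (Poly_Mapping.single i (Suc n)) c
        = jet i * Poly_Mapping.single (Poly_Mapping.single i n) c"
        by (simp add: jet_def mult_single flip: single_add)
      moreover have "eval_dp (total_deriv (jet i)) u = dx (eval_dp (jet i) u)"
        by (simp add: total_deriv_jet eval_dp_jet)
      ultimately show ?case using mult Suc by simp
    qed
  next
    case (add a b)
    have "Poly_Mapping.single (a + b) c = Poly_Mapping.single a c * Poly_Mapping.single b 1"
      by (simp add: mult_single)
    then show ?case using mult add by simp
  qed
qed (simp add: total_deriv_add eval_dp_add dx_add)

text \<open>
  A copy of \<open>diff_poly\<close>, because the total derivative exists only for this one instance of the
  type constructor, and class instances are declared for type constructors.
\<close>

typedef dpoly = "UNIV :: diff_poly set"
  morphisms poly_of_dpoly dpoly_of_poly ..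

setup_lifting type_definition_dpoly

instantiation dpoly :: diff_algebra
begin

lift_definition zero_dpoly :: dpoly is "0 :: diff_poly" .
lift_definition one_dpoly :: dpoly is "1 :: diff_poly" .
lift_definition plus_dpoly :: "dpoly \<Rightarrow> dpoly \<Rightarrow> dpoly" is "\<lambda>p q :: diff_poly. p + q" .
lift_definition minus_dpoly :: "dpoly \<Rightarrow> dpoly \<Rightarrow> dpoly" is "\<lambda>p q :: diff_poly. p - q" .
lift_definition uminus_dpoly :: "dpoly \<Rightarrow> dpoly" is "\<lambda>p :: diff_poly. - p" .
lift_definition times_dpoly :: "dpoly \<Rightarrow> dpoly \<Rightarrow> dpoly" is "\<lambda>p q :: diff_poly. p * q" .
lift_definition scaleR_dpoly :: "real \<Rightarrow> dpoly \<Rightarrow> dpoly" is "\<lambda>c p. const_dp c * p" .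
lift_definition dx_dpoly :: "dpoly \<Rightarrow> dpoly" is total_deriv .

instance
proof
  fix a b :: real and x y z :: dpoly
  show "x + y + z = x + (y + z)" "x + y = y + x" "0 + x = x" "- x + x = 0" "x - y = x + - y"
    "x * y * z = x * (y * z)" "x * y = y * x" "1 * x = x" "(x + y) * z = x * z + y * z" "(0 :: dpoly) \<noteq> 1"
    "x * (y + z) = x * y + x * z" "x * 1 = x"
    by (transfer; simp add: algebra_simps)+
  show "a *\<^sub>R (x + y) = a *\<^sub>R x + a *\<^sub>R y" "a *\<^sub>R x * y = a *\<^sub>R (x * y)" "x * a *\<^sub>R y = a *\<^sub>R (x * y)"
    by (transfer; simp add: algebra_simps)+
  show "(a + b) *\<^sub>R x = a *\<^sub>R x + b *\<^sub>R x"
    by transfer (simp add: const_dp_def single_add algebra_simps)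
  show "a *\<^sub>R b *\<^sub>R x = (a * b) *\<^sub>R x"
    by transfer (simp add: const_dp_def mult_single flip: mult.assoc)
  show "1 *\<^sub>R x = x"
    by transfer (simp add: const_dp_def)
  show "dx (x + y) = dx x + dx y" by transfer (rule total_deriv_add)
  show "dx (a *\<^sub>R x) = a *\<^sub>R dx x" by transfer (rule total_deriv_const_mult)
  show "dx (x * y) = dx x * y + x * dx y" by transfer (rule total_deriv_mult)
qed

end

section \<open>Homomorphisms of differential algebras\<close>

text \<open>The case distinction keeps the image bounded above in order for every function
  \<open>h\<close>.\<close>

lift_definition pdo_map :: "('a::zero \<Rightarrow> 'b::zero) \<Rightarrow> 'a pdo \<Rightarrow> 'b pdo" is
  "\<lambda>h p i. if p i = 0 then 0 else h (p i)"
  by (metis (full_types))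

locale diff_algebra_hom =
  fixes h :: "'a::diff_algebra \<Rightarrow> 'b::diff_algebra"
  assumes hom_add: "h (f + g) = h f + h g"
    and hom_scaleR: "h (c *\<^sub>R f) = c *\<^sub>R h f"
    and hom_mult: "h (f * g) = h f * h g"
    and hom_one: "h 1 = 1"
    and hom_dx: "h (dx f) = dx (h f)"
begin

lemma hom_zero: "h 0 = 0"
  using hom_scaleR[of 0 0] by simp

lemma hom_sum: "h (sum g A) = (\<Sum>x\<in>A. h (g x))"
  by (induction A rule: infinite_finite_induct) (simp_all add: hom_zero hom_add)

lemma hom_dx_funpow: "h ((dx ^^ n) f) = (dx ^^ n) (h f)"
  by (induction n) (simp_all add: hom_dx)

lemma coeff_map: "pdo_coeff (pdo_map h P) i = h (pdo_coeff P i)"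
  using hom_zero by transfer simp

lemma order_le_map: "order_le P N \<Longrightarrow> order_le (pdo_map h P) N"
  by (simp add: order_le_def coeff_map hom_zero)

lemma map_add: "pdo_map h (P + Q) = pdo_map h P + pdo_map h Q"
  by (rule pdo_eqI) (simp add: coeff_map hom_add)

lemma map_monom: "pdo_map h (pdo_monom f i) = pdo_monom (h f) i"
  by (rule pdo_eqI) (simp add: coeff_map coeff_monom hom_zero)

lemma map_mult: "pdo_map h (P * Q) = pdo_map h P * pdo_map h Q"
proof -
  obtain N M where P: "order_le P N" and Q: "order_le Q M" using order_le_exists by metis
  show ?thesis
    by (rule pdo_eqI) (simp add: coeff_map coeff_mult[OF P Q] coeff_mult[OF order_le_map[OF P] order_le_map[OF Q]]
        hom_sum hom_scaleR hom_mult hom_dx_funpow)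
qed

lemma map_power: "pdo_map h (P ^ n) = pdo_map h P ^ n"
  by (induction n) (simp_all add: map_mult one_pdo_def map_monom hom_one)

lemma map_plus_part: "pdo_map h (pdo_plus_part P) = pdo_plus_part (pdo_map h P)"
  by (rule pdo_eqI) (simp add: coeff_map coeff_plus_part hom_zero)

lemma hom_apply: "h (pdo_apply P f) = pdo_apply (pdo_map h P) (h f)"
  by (simp add: pdo_apply_eq_coeff map_mult map_monom flip: coeff_map)

lemma map_lax: "pdo_map h (cckp_lax q q) = cckp_lax (h q) (h q)"
  by (simp add: cckp_lax_def map_add map_mult map_monom hom_one)

text \<open>The right-hand side is built from ring operations and \<open>dx\<close> alone, so one
  computation for a generic q covers all algebras.\<close>

lemma hom_cckp_rhs: "h (cckp_rhs q m) = cckp_rhs (h q) m"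
  by (simp add: cckp_rhs_def hom_apply cckp_B_def map_plus_part map_power map_lax)

lemma hom_cckp_residue: "h (cckp_residue q m) = cckp_residue (h q) m"
  by (simp add: cckp_residue_def map_power map_lax flip: coeff_map)

end

text \<open>At q = 0 the Lax operator is \<partial>, whose powers have no residue; this fixes a
  constant of integration.\<close>

lemma cckp_residue_0: "cckp_residue (0 :: 'a::diff_algebra) m = 0"
proof -
  have "pdo_monom 0 i = (0 :: 'a pdo)" for i
    by (rule pdo_eqI) (simp add: coeff_monom)
  then have "cckp_lax 0 0 = (pdo_D :: 'a pdo)"
    by (simp add: cckp_lax_def)
  moreover have "pdo_D ^ m = (pdo_monom 1 (int m) :: 'a pdo)"
    by (induction m) (simp_all add: one_pdo_def pdo_monom_mult_D)
  ultimately show ?thesis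
    by (simp add: cckp_residue_def coeff_monom)
qed

lemma pdo_apply_0: "pdo_apply P 0 = 0"
proof -
  have "pdo_monom 0 0 = (0 :: 'a pdo)"
    by (rule pdo_eqI) (simp add: coeff_monom)
  then show ?thesis by (simp add: pdo_apply_eq_coeff)
qed

section \<open>Evaluation as a homomorphism and uniqueness of antiderivatives\<close>

definition dpoly_eval :: "'a::diff_algebra \<Rightarrow> dpoly \<Rightarrow> 'a" where
  "dpoly_eval u p = eval_dp (poly_of_dpoly p) u"

lemma diff_algebra_hom_eval: "diff_algebra_hom (dpoly_eval u)"
  by unfold_locales (simp_all add: dpoly_eval_def plus_dpoly.rep_eq eval_dp_add scaleR_dpoly.rep_eq eval_dp_mult
      eval_dp_const times_dpoly.rep_eq one_dpoly.rep_eq eval_dp_one dx_dpoly.rep_eq eval_dp_total_deriv)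

lemma lookup_0_eq_0_iff: "Poly_Mapping.lookup (poly_of_dpoly p) 0 = 0 \<longleftrightarrow> dpoly_eval (0 :: dpoly) p = 0"
  by (simp add: dpoly_eval_def eval_dp_at_0)

lemma dpoly_eqI:
  assumes "dx p = dx q" "dpoly_eval (0 :: dpoly) p = dpoly_eval 0 q"
  shows "p = (q :: dpoly)"
proof -
  interpret diff_algebra_hom "dpoly_eval (0 :: dpoly)" by (rule diff_algebra_hom_eval)
  have "dx (p - q) = 0"
    using dx_add[of "p - q" q] assms(1) by simp
  moreover have "dpoly_eval (0 :: dpoly) (p - q) = 0"
    using hom_add[of "p - q" q] assms(2) by simp
  ultimately have "total_deriv (poly_of_dpoly (p - q)) = 0" "Poly_Mapping.lookup (poly_of_dpoly (p - q)) 0 = 0"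
    by (simp_all only: lookup_0_eq_0_iff dx_dpoly.rep_eq[symmetric] zero_dpoly.rep_eq)
  then have "poly_of_dpoly (p - q) = poly_of_dpoly 0"
    unfolding zero_dpoly.rep_eq by (rule total_deriv_eq_0_imp)
  then have "p - q = 0" by (simp only: poly_of_dpoly_inject)
  then show ?thesis by simp
qed


section \<open>The recursion operator\<close>

definition dpoly_var :: dpoly where
  "dpoly_var = dpoly_of_poly (jet 0)"

lemma poly_of_dpoly_var: "poly_of_dpoly dpoly_var = jet 0"
  by (simp add: dpoly_var_def dpoly_of_poly_inverse)

lemma dpoly_eval_var: "dpoly_eval u dpoly_var = u"
  by (simp add: dpoly_eval_def poly_of_dpoly_var eval_dp_jet)

abbreviation (input) "mkdv_scale \<equiv> sqrt 3 / 6"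

abbreviation "generic_q \<equiv> mkdv_scale *\<^sub>R dpoly_var"

text \<open>Division by the scale converts the evolution of q into that of u.\<close>

definition mkdv_poly :: "nat \<Rightarrow> dpoly" where
  "mkdv_poly m = (1 / mkdv_scale) *\<^sub>R cckp_rhs generic_q m"

text \<open>The residue has derivative 4 q f, which is u K / 3 for q and f equal to u and K times
  the scale, K being \<open>mkdv_poly m\<close>; hence the factor 3.\<close>

definition mkdv_antideriv :: "nat \<Rightarrow> dpoly" where
  "mkdv_antideriv m = 3 *\<^sub>R cckp_residue generic_q m"

lemma cckp_rhs_generic: "cckp_rhs generic_q m = mkdv_scale *\<^sub>R mkdv_poly m"
  by (simp add: mkdv_poly_def)

lemma dpoly_eval_0_generic: "dpoly_eval (0 :: dpoly) generic_q = 0"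
proof -
  interpret diff_algebra_hom "dpoly_eval (0 :: dpoly)" by (rule diff_algebra_hom_eval)
  show ?thesis by (simp add: hom_scaleR dpoly_eval_var)
qed

lemma dpoly_eval_0_residue: "dpoly_eval (0 :: dpoly) (cckp_residue generic_q m) = 0"
proof -
  interpret diff_algebra_hom "dpoly_eval (0 :: dpoly)" by (rule diff_algebra_hom_eval)
  show ?thesis by (simp add: hom_cckp_residue dpoly_eval_0_generic cckp_residue_0)
qed

lemma dpoly_eval_0_apply: "dpoly_eval (0 :: dpoly) (pdo_apply P generic_q) = 0"
proof -
  interpret diff_algebra_hom "dpoly_eval (0 :: dpoly)" by (rule diff_algebra_hom_eval)
  show ?thesis by (simp add: hom_apply dpoly_eval_0_generic pdo_apply_0)
qed

lemma scale_square: "mkdv_scale * mkdv_scale = 1 / 12"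
  by (simp add: field_simps)

lemma numeral_mult_eq_scaleR: "numeral n * (x :: 'a::real_algebra_1) = numeral n *\<^sub>R x"
  by (simp add: scaleR_conv_of_real)

lemma dx_mkdv_antideriv:
  assumes "odd m"
  shows "dx (mkdv_antideriv m) = dpoly_var * mkdv_poly m"
proof -
  interpret cckp_diag generic_q m using assms by unfold_locales
  have "dx (mkdv_antideriv m) = (12 * (mkdv_scale * mkdv_scale)) *\<^sub>R (dpoly_var * mkdv_poly m)"
    by (simp add: mkdv_antideriv_def dx_scaleR dx_residue cckp_rhs_generic numeral_mult_eq_scaleR[where 'a = dpoly])
  then show ?thesis by (simp only: scale_square) simp
qed

lemma mkdv_poly_step:
  assumes "odd m"
  shows "mkdv_poly (m + 2) = dx (dx (mkdv_poly m)) + (2/3) *\<^sub>R (dpoly_var\<^sup>2 * mkdv_poly m)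
    + (2/3) *\<^sub>R (dx dpoly_var * mkdv_antideriv m)"
proof -
  interpret cckp_diag generic_q m using assms by unfold_locales
  interpret h: diff_algebra_hom "dpoly_eval (0 :: dpoly)" by (rule diff_algebra_hom_eval)
  \<comment> \<open>In the generic algebra a vanishing derivative leaves only a constant, and
    evaluation at 0 shows that this constant is 0.\<close>
  have T: "pdo_apply (cckp_T generic_q m) generic_q = 0"
    by (rule dpoly_eqI) (simp_all only: dx_apply_T dpoly_eval_0_apply dx_zero h.hom_zero)
  have Q: "pdo_apply (cckp_quotient generic_q m) generic_q + pdo_apply (cckp_quotient generic_q m) generic_q
      = cckp_residue generic_q m"
  proof (rule dpoly_eqI)
    show "dx (pdo_apply (cckp_quotient generic_q m) generic_q + pdo_apply (cckp_quotient generic_q m) generic_q)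
        = dx (cckp_residue generic_q m)"
      unfolding dx_add dx_apply_quotient dx_residue by simp
    show "dpoly_eval 0 (pdo_apply (cckp_quotient generic_q m) generic_q + pdo_apply (cckp_quotient generic_q m) generic_q)
        = dpoly_eval (0 :: dpoly) (cckp_residue generic_q m)"
      unfolding h.hom_add dpoly_eval_0_apply dpoly_eval_0_residue by simp
  qed
  have r: "2 * pdo_apply (cckp_quotient generic_q m) generic_q + cckp_residue generic_q m
      = (2/3) *\<^sub>R mkdv_antideriv m"
    unfolding mult_2 Q mkdv_antideriv_def by (simp add: scaleR_2)
  have "cckp_rhs generic_q (m + 2) = dx (dx (cckp_rhs generic_q m)) + 8 * generic_q\<^sup>2 * cckp_rhs generic_q m
      + dx generic_q * ((2/3) *\<^sub>R mkdv_antideriv m)"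
    unfolding cckp_rhs_step r T by simp
  \<comment> \<open>The scale squared is 1/12, so 8 becomes the 2/3 of the mKdV operator.\<close>
  also have "\<dots> = mkdv_scale *\<^sub>R (dx (dx (mkdv_poly m)) + (8 * (mkdv_scale * mkdv_scale)) *\<^sub>R (dpoly_var\<^sup>2 * mkdv_poly m)
      + (2/3) *\<^sub>R (dx dpoly_var * mkdv_antideriv m))"
    by (simp only: mult.assoc numeral_mult_eq_scaleR[where 'a = dpoly])
      (simp add: cckp_rhs_generic dx_scaleR power2_eq_square numeral_mult_eq_scaleR[where 'a = dpoly] scaleR_add_right mult.assoc
        mult.commute mult.left_commute)
  finally show ?thesis
    unfolding mkdv_poly_def[of "m + 2"] scale_square by simp
qed

lemma mkdv_poly_1: "poly_of_dpoly (mkdv_poly 1) = jet 1"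
proof -
  have "mkdv_poly 1 = dx dpoly_var"
    by (simp add: mkdv_poly_def cckp_rhs_1[unfolded One_nat_def] dx_scaleR)
  then show ?thesis by (simp add: dx_dpoly.rep_eq poly_of_dpoly_var total_deriv_jet)
qed

text \<open>The residue supplies an antiderivative; \<open>dpoly_eqI\<close> excludes any other with
  vanishing constant term.\<close>

lemma formal_antideriv_iff:
  assumes "odd m"
  shows "formal_antideriv (jet 0 * poly_of_dpoly (mkdv_poly m)) W \<longleftrightarrow> W = poly_of_dpoly (mkdv_antideriv m)"
proof -
  define w where "w = dpoly_of_poly W"
  have W: "W = poly_of_dpoly w" by (simp add: w_def dpoly_of_poly_inverse)
  interpret h: diff_algebra_hom "dpoly_eval (0 :: dpoly)" by (rule diff_algebra_hom_eval)
  have h0: "dpoly_eval (0 :: dpoly) (mkdv_antideriv m) = 0"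
    by (simp add: mkdv_antideriv_def h.hom_scaleR dpoly_eval_0_residue)
  have "formal_antideriv (jet 0 * poly_of_dpoly (mkdv_poly m)) W
      \<longleftrightarrow> dx w = dpoly_var * mkdv_poly m \<and> dpoly_eval (0 :: dpoly) w = 0"
    unfolding formal_antideriv_def W lookup_0_eq_0_iff
    by (simp add: dx_dpoly.rep_eq times_dpoly.rep_eq poly_of_dpoly_var flip: poly_of_dpoly_inject)
  also have "\<dots> \<longleftrightarrow> w = mkdv_antideriv m"
    using dpoly_eqI[of w "mkdv_antideriv m"] dx_mkdv_antideriv[OF assms] h0 by auto
  finally show ?thesis by (simp add: W poly_of_dpoly_inject)
qed

lemma poly_of_mkdv_poly_step:
  assumes "odd m"
  shows "poly_of_dpoly (mkdv_poly (m + 2)) = total_deriv (total_deriv (poly_of_dpoly (mkdv_poly m)))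
    + const_dp (2/3) * jet 0 ^ 2 * poly_of_dpoly (mkdv_poly m)
    + const_dp (2/3) * jet 1 * poly_of_dpoly (mkdv_antideriv m)"
  unfolding mkdv_poly_step[OF assms]
  by (simp add: plus_dpoly.rep_eq dx_dpoly.rep_eq scaleR_dpoly.rep_eq times_dpoly.rep_eq poly_of_dpoly_var
      total_deriv_jet power2_eq_square mult.assoc)

text \<open>Uniqueness: each recursion step is forced, because the antiderivative in it is.
  Existence is \<open>mkdv_rhs_mkdv_poly\<close>.\<close>

lemma mkdv_rhs_imp: "mkdv_rhs m K \<Longrightarrow> odd m \<and> K = poly_of_dpoly (mkdv_poly m)"
proof (induction rule: mkdv_rhs.induct)
  case trivial
  show ?case by (simp add: mkdv_poly_1[unfolded One_nat_def])
next
  case (recursion m K W)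
  then show ?case
    using formal_antideriv_iff[of m W] poly_of_mkdv_poly_step[of m] by simp
qed

lemma mkdv_rhs_mkdv_poly: "mkdv_rhs (2 * n + 1) (poly_of_dpoly (mkdv_poly (2 * n + 1)))"
proof (induction n)
  case 0
  then show ?case using mkdv_rhs.trivial mkdv_poly_1 by simp
next
  case (Suc n)
  have m: "odd (2 * n + 1)" by simp
  show ?case
    using mkdv_rhs.recursion[OF Suc formal_antideriv_iff[OF m, THEN iffD2, OF refl]]
    unfolding poly_of_mkdv_poly_step[OF m, symmetric] by simp
qed

lemma mkdv_flow_iff: "mkdv_flow Dt u (2 * n + 1) \<longleftrightarrow> Dt (2 * n + 1) u = dpoly_eval u (mkdv_poly (2 * n + 1))"
  unfolding mkdv_flow_def dpoly_eval_def using mkdv_rhs_mkdv_poly mkdv_rhs_imp by metis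

theorem corollary3p2:
  fixes Dt :: "nat \<Rightarrow> 'a::diff_algebra \<Rightarrow> 'a" and q r u :: 'a
  assumes "odd_time_derivatives Dt"
    and "q = r"
    and "q = (sqrt 3 / 6) *\<^sub>R u"
  shows "(\<forall>n. cckp_flow Dt q r (2 * n + 1) \<longleftrightarrow> mkdv_flow Dt u (2 * n + 1)) \<and>
         (cckp_hierarchy Dt q r \<longleftrightarrow> mkdv_hierarchy Dt u)"
proof -
  have "cckp_flow Dt q r (2 * n + 1) \<longleftrightarrow> mkdv_flow Dt u (2 * n + 1)" for n
  proof -
    define m where "m = 2 * n + 1"
    have m: "odd m" by (simp add: m_def)
    then have D: "time_derivative (Dt m)"
      using assms(1) by (simp add: odd_time_derivatives_def)
    interpret h: diff_algebra_hom "dpoly_eval u" by (rule diff_algebra_hom_eval)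
    \<comment> \<open>Evaluation specialises the generic q to the given one and carries the generic
      right-hand side along.\<close>
    have "dpoly_eval u generic_q = q"
      by (simp add: h.hom_scaleR dpoly_eval_var assms(3))
    then have "cckp_rhs q m = dpoly_eval u (cckp_rhs generic_q m)"
      by (simp only: h.hom_cckp_rhs)
    also have "\<dots> = mkdv_scale *\<^sub>R dpoly_eval u (mkdv_poly m)"
      by (simp only: cckp_rhs_generic h.hom_scaleR)
    finally have rhs: "cckp_rhs q m = mkdv_scale *\<^sub>R dpoly_eval u (mkdv_poly m)" .
    have Dq: "Dt m q = mkdv_scale *\<^sub>R Dt m u"
      using D unfolding assms(3) time_derivative_def by blast
    have "cckp_flow Dt q r m \<longleftrightarrow> Dt m q = cckp_rhs q m"
      using cckp_flow_diag_iff[of Dt m q, OF D m] assms(2) by simp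
    also have "\<dots> \<longleftrightarrow> mkdv_scale *\<^sub>R Dt m u = mkdv_scale *\<^sub>R dpoly_eval u (mkdv_poly m)"
      by (simp only: rhs Dq)
    \<comment> \<open>The scale is a nonzero real and cancels even in the presence of zero
      divisors.\<close>
    also have "\<dots> \<longleftrightarrow> mkdv_flow Dt u m"
      unfolding m_def mkdv_flow_iff scaleR_cancel_left by simp
    finally show ?thesis by (simp only: m_def)
  qed
  then show ?thesis by (simp add: cckp_hierarchy_def mkdv_hierarchy_def)
qed

end
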